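(* Let $\lambda>0$, $P>0$, $N_0>0$, $r_0>0$, $\eta>2$. Consider the downlink of a single-tier cellular network modeled via a Poisson point process of intensity $\lambda$, with Rayleigh fading, universal frequency reuse, nearest-base-station association and no intra-cell interference, and let $\Upsilon$ be the SINR, as defined in the context, of a user located at distance $r_0$ from its serving base station. Then: (i) the ergodic rate $\mathcal C(r_0)=\mathbb E\{\ln(1+\Upsilon)\}$ is $$\mathcal{C}(r_0)=\int_0^{\infty}\frac{1}{t+1}\exp\left\{-\frac{tN_0r_0^{\eta}}{P}-\frac{2\pi\lambda t r_0^{2}}{\eta-2}\,{}_2F_1\left(1,1-\frac2\eta;2-\frac2\eta;-t\right)\right\}\mathrm dt,$$ and in the case $\eta=4$ this equals $$\int_0^{\infty}\frac{1}{t+1}\exp\left\{-\frac{tN_0r_0^{4}}{P}-\pi\lambda\sqrt t\,r_0^{2}\arctan\left(\sqrt t\right)\right\}\mathrm dt;$$ (ii) for every $T>0$, the outage probability $\mathcal O(r_0,T)=\mathbb P\{\Upsilon<T\}$ is $$\mathcal{O}(r_0,T)=1-\exp\left\{-\frac{TN_0r_0^{\eta}}{P}-\frac{2\pi\lambda T r_0^{2}}{\eta-2}\,{}_2F_1\left(1,1-\frac2\eta;2-\frac2\eta;-T\right)\right\},$$ and in the case $\eta=4$ this equals $$1-\exp\left\{-\frac{TN_0r_0^{4}}{P}-\pi\lambda\sqrt T\,r_0^{2}\arctan\left(\sqrt T\right)\right\}.$$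
   Context: Network. All base stations (BSs) form a homogeneous Poisson point process in $\mathbb R^2$ of intensity $\lambda$. All BSs transmit with power $P$ on the same channel. The test user is at the origin and is served by its nearest BS, at distance $r_0$. Everything is conditioned on $r_0$, so the interfering BSs form a homogeneous Poisson point process of intensity $\lambda$ on $\{x\in\mathbb R^2:\|x\|>r_0\}$. Let $\{r_k\}_{k\ge1}$ be the distances of the interfering BSs to the origin. The fading coefficients $h_0$ (serving link) and $h_k$, $k\ge1$ (interfering links) are i.i.d. circularly symmetric complex Gaussian with mean $0$ and variance $1$ (Rayleigh fading, so $|h_0|^2,|h_k|^2$ are exponential with mean $1$), independent of the point process. $N_0$ is the noise variance and $\eta$ is the path-loss exponent. SINR. Treating interference as noise with Gaussian transmitted signals, the signal-to-interference-plus-noise ratio is $$\Upsilon=\frac{P|h_0|^2r_0^{-\eta}}{\mathcal I_{agg}+N_0},\qquad \mathcal I_{agg}=\sum_{k\ge1}P|h_k|^2r_k^{-\eta}.$$ Expectations and probabilities are over the fading and the point process, with $r_0$ fixed. Rates are per unit bandwidth, with natural logarithm. Notation. ${}_2F_1(a,b;c;x)$ is the Gauss hypergeometric function, given by $\sum_{n\ge0}\frac{(a)_n(b)_n}{(c)_n}\frac{x^n}{n!}$ for $|x|<1$ with $(a)_n=\Gamma(a+n)/\Gamma(a)$, and by analytic continuation to $\mathbb C\setminus[1,\infty)$ otherwise. *)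

theory Defs
  imports "HOL-Probability.Probability" "HOL-Complex_Analysis.Complex_Analysis"
begin

subsection \<open>The Gauss hypergeometric function\<close>

abbreviation slit_plane :: "complex set" where
  "slit_plane \<equiv> - (complex_of_real ` {1..})"

definition is_hyp2F1 :: "complex \<Rightarrow> complex \<Rightarrow> complex \<Rightarrow> (complex \<Rightarrow> complex) \<Rightarrow> bool" where
  "is_hyp2F1 a b c F \<longleftrightarrow> F holomorphic_on slit_plane \<and>
     (\<forall>z\<in>ball 0 1. (\<lambda>n. pochhammer a n * pochhammer b n / pochhammer c n * z ^ n / fact n) sums F z)"

text \<open>
  The analytic continuation is unique only as a function on the slit plane, so the definite
  description ranges over its value at \<open>z\<close>. On the cut itself the value is unspecified.
\<close>
definition hyp2F1 :: "complex \<Rightarrow> complex \<Rightarrow> complex \<Rightarrow> complex \<Rightarrow> complex" where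
  "hyp2F1 a b c z = (THE w. \<exists>F. is_hyp2F1 a b c F \<and> w = F z)"

lemma open_slit_plane: "open slit_plane"
  by (simp add: closed_slot_right open_Compl)

lemma starlike_slit_plane: "z \<in> slit_plane \<Longrightarrow> closed_segment 0 z \<subseteq> slit_plane"
proof
  fix x assume z: "z \<in> slit_plane" and "x \<in> closed_segment 0 z"
  then obtain u where u: "0 \<le> u" "u \<le> 1" "x = of_real u * z"
    by (auto simp: closed_segment_def scaleR_conv_of_real)
  show "x \<in> slit_plane"
  proof
    assume "x \<in> complex_of_real ` {1..}"
    then have x: "1 \<le> u * Re z" "u * Im z = 0"
      using u by (auto simp: complex_slot_right_eq)
    then have "u \<noteq> 0" by auto
    with x have "Im z = 0" by simp
    have "0 < Re z"
    proof (rule ccontr)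
      assume "\<not> 0 < Re z"
      then have "u * Re z \<le> 0" using u(1) by (simp add: mult_nonneg_nonpos)
      with x(1) show False by simp
    qed
    then have "u * Re z \<le> Re z" using u by (intro mult_left_le_one_le) auto
    with x(1) have "1 \<le> Re z" by simp
    with \<open>Im z = 0\<close> z show False by (auto simp: complex_slot_right_eq)
  qed
qed

lemma connected_slit_plane: "connected slit_plane"
proof (rule starlike_imp_connected)
  have "0 \<in> slit_plane" by (auto simp: complex_slot_right_eq)
  then show "starlike slit_plane"
    unfolding starlike_def using starlike_slit_plane by blast
qed

lemma ball_subset_slit_plane: "ball 0 1 \<subseteq> slit_plane"
  by auto

lemma is_hyp2F1_unique:
  assumes "is_hyp2F1 a b c F" "is_hyp2F1 a b c G" "z \<in> slit_plane"
  shows "F z = G z"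
proof -
  have "F w = G w" if "w \<in> ball 0 1" for w
    using assms that sums_unique2 unfolding is_hyp2F1_def by blast
  moreover have "F holomorphic_on slit_plane" "G holomorphic_on slit_plane"
    using assms unfolding is_hyp2F1_def by blast+
  moreover have "ball (0::complex) 1 \<noteq> {}" by simp
  ultimately show ?thesis
    using analytic_continuation_open[OF open_ball open_slit_plane _ connected_slit_plane
        ball_subset_slit_plane _ _ _ assms(3)] by blast
qed

lemma hyp2F1_eqI:
  assumes "is_hyp2F1 a b c F" "z \<in> slit_plane"
  shows "hyp2F1 a b c z = F z"
  unfolding hyp2F1_def using assms is_hyp2F1_unique by (intro the_equality) blast+

text \<open>
  Well-definedness for the parameters \<open>1\<close>, \<open>b\<close>, \<open>b + 1\<close> with real \<open>b > 0\<close>, from Euler's integral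
  \<open>b \<integral>\<^sub>0\<^sup>1 s\<^sup>b\<^sup>-\<^sup>1 / (1 - z s) ds\<close> after substituting \<open>s = u\<^sup>1\<^sup>/\<^sup>b\<close>.
\<close>
definition euler_2F1 :: "real \<Rightarrow> complex \<Rightarrow> complex" where
  "euler_2F1 b z = integral {0..1} (\<lambda>u. 1 / (1 - z * of_real (u powr (1 / b))))"

lemma euler_denom_nz:
  assumes "b > 0" "u \<in> {0..1}" "z \<in> slit_plane"
  shows "1 - z * complex_of_real (u powr (1 / b)) \<noteq> 0"
proof
  assume *: "1 - z * complex_of_real (u powr (1 / b)) = 0"
  have "0 \<le> u powr (1 / b)" "u powr (1 / b) \<le> 1"
    using assms by (auto intro!: powr_le1)
  then have "of_real (u powr (1 / b)) * z \<in> closed_segment 0 z"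
    by (auto simp: closed_segment_def scaleR_conv_of_real intro!: exI[of _ "u powr (1 / b)"])
  with starlike_slit_plane[OF assms(3)] have "of_real (u powr (1 / b)) * z \<in> slit_plane" by blast
  moreover have "of_real (u powr (1 / b)) * z = complex_of_real 1" using * by (simp add: mult.commute)
  ultimately show False by auto
qed

lemma continuous_on_powr_inverse:
  assumes "b > 0"
  shows "continuous_on {0..1} (\<lambda>u::real. complex_of_real (u powr (1 / b)))"
proof -
  have "continuous_on {0..1} (\<lambda>u::real. u powr (1 / b))"
    by (rule continuous_on_powr') (use assms in \<open>auto intro!: continuous_intros\<close>)
  then show ?thesis by (rule continuous_on_of_real)
qed

lemma holomorphic_euler_2F1:
  assumes b: "b > 0"
  shows "euler_2F1 b holomorphic_on slit_plane"
proof -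
  have ball: "euler_2F1 b holomorphic_on ball w e" if sub: "ball w e \<subseteq> slit_plane" for w e
  proof -
    have nz: "1 - z * complex_of_real (u powr (1 / b)) \<noteq> 0" if "z \<in> ball w e" "u \<in> {0..1}" for z u
      using euler_denom_nz[OF b that(2)] sub that(1) by blast
    have cont: "continuous_on (ball w e \<times> {0..1}) (\<lambda>p. complex_of_real (snd p powr (1 / b)))"
      by (rule continuous_on_compose2[OF continuous_on_powr_inverse[OF b]])
        (auto intro!: continuous_on_snd continuous_on_id)
    have "(\<lambda>z. integral (cbox 0 1) (\<lambda>u. 1 / (1 - z * complex_of_real (u powr (1 / b)))))
        holomorphic_on ball w e"
    proof (rule leibniz_rule_holomorphic[where fx = "\<lambda>z u. of_real (u powr (1 / b)) /
             (1 - z * complex_of_real (u powr (1 / b)))\<^sup>2"])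
      fix z u assume "z \<in> ball w e" "u \<in> cbox 0 (1::real)"
      then have "1 - z * complex_of_real (u powr (1 / b)) \<noteq> 0" using nz by simp
      then show "((\<lambda>z. 1 / (1 - z * complex_of_real (u powr (1 / b)))) has_field_derivative
          of_real (u powr (1 / b)) / (1 - z * complex_of_real (u powr (1 / b)))\<^sup>2)
          (at z within ball w e)"
        by (auto intro!: derivative_eq_intros simp: power2_eq_square)
    next
      fix z assume z: "z \<in> ball w e"
      have "continuous_on {0..1} (\<lambda>u. 1 / (1 - z * complex_of_real (u powr (1 / b))))"
        by (rule continuous_on_divide)
          (use nz[OF z] in \<open>auto intro!: continuous_on_diff continuous_on_mult
             continuous_on_const continuous_on_powr_inverse[OF b]\<close>)
      then show "(\<lambda>u. 1 / (1 - z * complex_of_real (u powr (1 / b)))) integrable_on cbox 0 1"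
        by (simp add: integrable_continuous_real)
    next
      have "continuous_on (ball w e \<times> {0..1}) (\<lambda>p. of_real (snd p powr (1 / b)) /
             (1 - fst p * complex_of_real (snd p powr (1 / b)))\<^sup>2)"
        by (intro continuous_on_divide[OF cont] continuous_on_power continuous_on_diff
            continuous_on_mult[OF _ cont] continuous_on_const continuous_on_fst continuous_on_id)
          (use nz in auto)
      then show "continuous_on (ball w e \<times> cbox 0 1) (\<lambda>(z, u). of_real (u powr (1 / b)) /
             (1 - z * complex_of_real (u powr (1 / b)))\<^sup>2)"
        by (simp add: split_beta)
    qed (rule convex_ball)
    then show ?thesis by (simp add: euler_2F1_def[abs_def])
  qed
  have "euler_2F1 b field_differentiable at z" if z: "z \<in> slit_plane" for z
  proof -
    obtain e where e: "e > 0" "ball z e \<subseteq> slit_plane"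
      by (rule openE[OF open_slit_plane z])
    show ?thesis
      using holomorphic_on_imp_differentiable_at[OF ball[OF e(2)]] e(1) by simp
  qed
  then show ?thesis
    by (simp add: holomorphic_on_def field_differentiable_at_within)
qed

lemma sums_euler_2F1:
  assumes b: "b > 0" and z: "norm z < 1"
  shows "(\<lambda>n. pochhammer 1 n * pochhammer (of_real b) n / pochhammer (of_real (b + 1)) n * z ^ n / fact n)
           sums euler_2F1 b z"
proof -
  let ?g = "\<lambda>n u. (z * complex_of_real (u powr (1 / b))) ^ n"
  have le: "norm (z * complex_of_real (u powr (1 / b))) \<le> norm z" if "u \<in> {0..1}" for u
  proof -
    have "u powr (1 / b) \<le> 1" using that b by (intro powr_le1) auto
    then show ?thesis by (simp add: norm_mult mult_left_le)
  qed
  have int: "(?g n has_integral (z ^ n * of_real (b / (b + n)))) {0..1}" for n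
  proof -
    have "0 \<le> real n / b" using b by simp
    then have "((\<lambda>u. u powr (n / b)) has_integral (1 / (n / b + 1))) {0..1::real}"
      using has_integral_powr_from_0[of "n / b" 1] by simp
    moreover have "1 / (n / b + 1) = b / (b + n)" using b by (simp add: field_simps)
    ultimately have "((\<lambda>u. z ^ n * of_real (u powr (n / b))) has_integral
        z ^ n * of_real (b / (b + n))) {0..1}"
      by (metis has_integral_mult_right has_integral_of_real)
    moreover have "?g n u = z ^ n * of_real (u powr (n / b))" if "u \<in> {0..1} - {0}" for u
    proof -
      have "(u powr (1 / b)) ^ n = u powr (n / b)"
        using that by (simp add: powr_powr flip: powr_realpow)
      then show ?thesis by (simp add: power_mult_distrib flip: of_real_power)
    qed
    ultimately show ?thesis
      by (intro has_integral_spike_finite[of "{0}" "{0..1}" "?g n"]) auto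
  qed
  have "uniform_limit {0..1} (\<lambda>N u. \<Sum>n<N. ?g n u) (\<lambda>u. \<Sum>n. ?g n u) sequentially"
    by (rule Weierstrass_m_test[where M = "\<lambda>n. norm z ^ n"])
      (use z le in \<open>auto simp only: norm_power intro!: power_mono summable_geometric\<close>, auto)
  moreover have "(\<Sum>n. ?g n u) = 1 / (1 - z * of_real (u powr (1 / b)))" if "u \<in> {0..1}" for u
    using le[OF that] z by (intro suminf_geometric) simp
  ultimately have "uniform_limit {0..1} (\<lambda>N u. \<Sum>n<N. ?g n u)
      (\<lambda>u. 1 / (1 - z * of_real (u powr (1 / b)))) sequentially"
    by (subst (asm) uniform_limit_cong'[where g = "\<lambda>N u. \<Sum>n<N. ?g n u"
          and i = "\<lambda>u. 1 / (1 - z * of_real (u powr (1 / b)))"]) auto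
  moreover have "continuous_on {0..1} (\<lambda>u. \<Sum>n<N. ?g n u)" for N
    by (intro continuous_on_sum continuous_on_power continuous_on_mult continuous_on_const
        continuous_on_powr_inverse b)
  ultimately obtain I J where I: "\<And>N. ((\<lambda>u. \<Sum>n<N. ?g n u) has_integral I N) {0..1}"
    and J: "((\<lambda>u. 1 / (1 - z * of_real (u powr (1 / b)))) has_integral J) {0..1}"
    and lim: "I \<longlonglongrightarrow> J"
    by (rule uniform_limit_integral) auto
  have "I N = (\<Sum>n<N. z ^ n * of_real (b / (b + n)))" for N
    by (rule has_integral_unique[OF I has_integral_sum]) (use int in auto)
  then have "I = (\<lambda>N. \<Sum>n<N. z ^ n * of_real (b / (b + n)))" by (rule ext)
  moreover have "J = euler_2F1 b z"
    using J by (simp add: euler_2F1_def integral_unique)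
  ultimately have "(\<lambda>n. z ^ n * of_real (b / (b + n))) sums euler_2F1 b z"
    using lim unfolding sums_def by (simp only:)
  moreover have "pochhammer 1 n * pochhammer (of_real b) n / pochhammer (of_real (b + 1)) n * z ^ n / fact n
      = z ^ n * complex_of_real (b / (b + n))" for n
  proof -
    have nz: "pochhammer (b + 1) n \<noteq> 0" using pochhammer_pos[of "b + 1" n] b by simp
    have "b * pochhammer (b + 1) n = (b + n) * pochhammer b n"
      using pochhammer_rec[of b n] pochhammer_rec'[of b n] by simp
    then have "pochhammer b n / pochhammer (b + 1) n = b / (b + n)"
      using nz b by (simp add: field_simps)
    then have "pochhammer (of_real b) n / pochhammer (of_real (b + 1)) n = complex_of_real (b / (b + n))"
      by (metis of_real_divide pochhammer_of_real)
    moreover have "pochhammer 1 n * p / q * z ^ n / fact n = z ^ n * (p / q)" for p q :: complex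
      by (simp add: pochhammer_fact[symmetric])
    ultimately show ?thesis by (simp only:)
  qed
  ultimately show ?thesis by (simp only:)
qed

lemma is_hyp2F1_euler:
  "b > 0 \<Longrightarrow> is_hyp2F1 1 (of_real b) (of_real (b + 1)) (euler_2F1 b)"
  using holomorphic_euler_2F1 sums_euler_2F1 unfolding is_hyp2F1_def by simp

lemma hyp2F1_real:
  assumes "b > 0" "x < 1"
  shows "hyp2F1 1 (of_real b) (of_real (b + 1)) (of_real x) \<in> \<real>"
proof -
  have x: "complex_of_real x \<in> slit_plane" using assms by (auto simp: complex_slot_right_eq)
  have nz: "1 - x * u powr (1 / b) \<noteq> 0" if "u \<in> {0..1}" for u
  proof
    assume "1 - x * u powr (1 / b) = 0"
    then have "complex_of_real (1 - x * u powr (1 / b)) = 0" by (simp only: of_real_0)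
    with euler_denom_nz[OF assms(1) that x] show False by simp
  qed
  have "continuous_on {0..1} (\<lambda>u::real. u powr (1 / b))"
    by (rule continuous_on_powr') (use assms in \<open>auto intro!: continuous_intros\<close>)
  then have "continuous_on {0..1} (\<lambda>u. 1 / (1 - x * u powr (1 / b)))"
    by (intro continuous_on_divide continuous_on_diff continuous_on_mult continuous_on_const)
      (use nz in auto)
  then obtain I where "((\<lambda>u. 1 / (1 - x * u powr (1 / b))) has_integral I) {0..1}"
    using integrable_continuous_real by blast
  then have "((\<lambda>u. complex_of_real (1 / (1 - x * u powr (1 / b)))) has_integral of_real I) {0..1}"
    by (rule has_integral_of_real)
  then have "euler_2F1 b (of_real x) = of_real I"
    by (simp add: euler_2F1_def integral_unique)
  then show ?thesis
    using hyp2F1_eqI[OF is_hyp2F1_euler[OF assms(1)] x] by simp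
qed

subsection \<open>Fading, interferers and SINR\<close>

text \<open>\<^const>\<open>prob_space.indep_var\<close> requires both variables to take values in the same type.\<close>
definition indep_rvs ::
    "'w measure \<Rightarrow> 'a measure \<Rightarrow> ('w \<Rightarrow> 'a) \<Rightarrow> 'b measure \<Rightarrow> ('w \<Rightarrow> 'b) \<Rightarrow> bool" where
  "indep_rvs M S X T Y \<longleftrightarrow> X \<in> measurable M S \<and> Y \<in> measurable M T \<and>
     prob_space.indep_set M {X -` A \<inter> space M | A. A \<in> sets S} {Y -` B \<inter> space M | B. B \<in> sets T}"

definition circular_complex_gaussian :: "'w measure \<Rightarrow> real \<Rightarrow> ('w \<Rightarrow> complex) \<Rightarrow> bool" where
  "circular_complex_gaussian M v Z \<longleftrightarrow>
     distributed M lborel (\<lambda>\<omega>. Re (Z \<omega>)) (normal_density 0 (sqrt (v / 2))) \<and>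
     distributed M lborel (\<lambda>\<omega>. Im (Z \<omega>)) (normal_density 0 (sqrt (v / 2))) \<and>
     prob_space.indep_var M borel (\<lambda>\<omega>. Re (Z \<omega>)) borel (\<lambda>\<omega>. Im (Z \<omega>))"

text \<open>
  A point process given by a measurable enumeration \<open>X\<close> of its points, counted with multiplicity.
  Since the enumeration never stops, this covers Poisson processes of infinite total intensity.
  The Poisson weights are written out because \<^const>\<open>poisson_pmf\<close> excludes rate \<open>0\<close>. The cardinality
  of an infinite set is \<open>0\<close>, hence the separate finiteness clause.
\<close>
definition poisson_point_process ::
    "'w measure \<Rightarrow> 'b measure \<Rightarrow> (nat \<Rightarrow> 'w \<Rightarrow> 'b) \<Rightarrow> bool" where
  "poisson_point_process M \<Lambda> X \<longleftrightarrow>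
     (\<forall>k. X k \<in> measurable M \<Lambda>) \<and>
     (\<forall>B\<in>sets \<Lambda>. emeasure \<Lambda> B < \<infinity> \<longrightarrow>
        (AE \<omega> in M. finite {k. X k \<omega> \<in> B}) \<and>
        (\<forall>n. measure M {\<omega>\<in>space M. card {k. X k \<omega> \<in> B} = n}
               = measure \<Lambda> B ^ n / fact n * exp (- measure \<Lambda> B))) \<and>
     (\<forall>(m::nat) B. (\<forall>i<m. B i \<in> sets \<Lambda> \<and> emeasure \<Lambda> (B i) < \<infinity>) \<and> disjoint_family_on B {..<m} \<longrightarrow>
        prob_space.indep_vars M (\<lambda>_. count_space UNIV) (\<lambda>i \<omega>. card {k. X k \<omega> \<in> B i}) {..<m})"

definition homogeneous_ppp_on ::
    "'w measure \<Rightarrow> real \<Rightarrow> 'b::euclidean_space set \<Rightarrow> (nat \<Rightarrow> 'w \<Rightarrow> 'b) \<Rightarrow> bool" where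
  "homogeneous_ppp_on M \<rho> A X \<longleftrightarrow>
     poisson_point_process M (density lborel (\<lambda>y. ennreal \<rho> * indicator A y)) X"

text \<open>
  \<open>h 0\<close> is the fading of the serving link; the interferer at \<open>x k\<close>, \<open>k \<ge> 0\<close>, has fading \<open>h (Suc k)\<close>.
  For \<open>\<eta> > 2\<close> and points outside a ball around the origin the series converges almost surely.
\<close>
definition interference ::
    "real \<Rightarrow> real \<Rightarrow> (nat \<Rightarrow> 'w \<Rightarrow> real^2) \<Rightarrow> (nat \<Rightarrow> 'w \<Rightarrow> complex) \<Rightarrow> 'w \<Rightarrow> real" where
  "interference P \<eta> x h \<omega> = (\<Sum>k. P * (cmod (h (Suc k) \<omega>))\<^sup>2 * norm (x k \<omega>) powr (- \<eta>))"

definition sinr ::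
    "real \<Rightarrow> real \<Rightarrow> real \<Rightarrow> real \<Rightarrow> (nat \<Rightarrow> 'w \<Rightarrow> real^2) \<Rightarrow> (nat \<Rightarrow> 'w \<Rightarrow> complex) \<Rightarrow> 'w \<Rightarrow> real" where
  "sinr P N\<^sub>0 \<eta> r\<^sub>0 x h \<omega> =
     P * (cmod (h 0 \<omega>))\<^sup>2 * r\<^sub>0 powr (- \<eta>) / (interference P \<eta> x h \<omega> + N\<^sub>0)"

definition ergodic_rate :: "'w measure \<Rightarrow> ('w \<Rightarrow> real) \<Rightarrow> real" where
  "ergodic_rate M Y = (\<integral>\<omega>. ln (1 + Y \<omega>) \<partial>M)"

definition outage_probability :: "'w measure \<Rightarrow> ('w \<Rightarrow> real) \<Rightarrow> real \<Rightarrow> real" where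
  "outage_probability M Y T = measure M {\<omega>\<in>space M. Y \<omega> < T}"

end

theory Submission
  imports Defs "HOL-Real_Asymp.Real_Asymp"
begin

text \<open>
  Since \<open>|h\<^sub>0|\<^sup>2\<close> is exponential, the event \<open>\<Upsilon> \<ge> T\<close> has conditional probability
  \<open>exp (- s (I + N\<^sub>0))\<close> with \<open>s = T r\<^sub>0\<^sup>\<eta> / P\<close>. Averaging over the other fading coefficients and then
  over the Poisson process by its Laplace functional turns this into
  \<open>exp (- s N\<^sub>0 - \<integral> (1 - 1 / (1 + T (r\<^sub>0 / |y|)\<^sup>\<eta>)) d\<Lambda>)\<close>, and a radial substitution identifies the
  integral with Euler's integral for \<open>\<^sub>2F\<^sub>1\<close>. The ergodic rate follows from
  \<open>E ln (1 + \<Upsilon>) = \<integral>\<^sub>0\<^sup>\<infinity> P(\<Upsilon> \<ge> t) / (1 + t) dt\<close>. To avoid conditioning on an infinite series, the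
  event \<open>\<Upsilon> \<ge> T\<close> is the decreasing limit of the events that involve only the first \<open>n\<close> interferers.
\<close>

section \<open>Independence of random elements with values in different types\<close>

lemma (in prob_space) distr_indep_rvs:
  assumes "indep_rvs M S X T Y"
  shows "distr M (S \<Otimes>\<^sub>M T) (\<lambda>\<omega>. (X \<omega>, Y \<omega>)) = distr M S X \<Otimes>\<^sub>M distr M T Y"
proof (rule sym, rule pair_measure_eqI)
  have [measurable]: "X \<in> measurable M S" "Y \<in> measurable M T"
    using assms by (auto simp: indep_rvs_def)
  interpret X: prob_space "distr M S X" by (rule prob_space_distr) simp
  interpret Y: prob_space "distr M T Y" by (rule prob_space_distr) simp
  show "sigma_finite_measure (distr M S X)" "sigma_finite_measure (distr M T Y)" ..
  show "sets (distr M S X \<Otimes>\<^sub>M distr M T Y) = sets (distr M (S \<Otimes>\<^sub>M T) (\<lambda>\<omega>. (X \<omega>, Y \<omega>)))"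
    by (simp cong: sets_pair_measure_cong)
  fix A B assume "A \<in> sets (distr M S X)" "B \<in> sets (distr M T Y)"
  then have [measurable]: "A \<in> sets S" "B \<in> sets T" by auto
  have "prob ((X -` A \<inter> space M) \<inter> (Y -` B \<inter> space M)) = prob (X -` A \<inter> space M) * prob (Y -` B \<inter> space M)"
    using assms by (auto simp: indep_rvs_def intro!: indep_setD)
  moreover have "(\<lambda>\<omega>. (X \<omega>, Y \<omega>)) -` (A \<times> B) \<inter> space M = (X -` A \<inter> space M) \<inter> (Y -` B \<inter> space M)"
    by auto
  ultimately show "emeasure (distr M S X) A * emeasure (distr M T Y) B =
      emeasure (distr M (S \<Otimes>\<^sub>M T) (\<lambda>\<omega>. (X \<omega>, Y \<omega>))) (A \<times> B)"
    by (simp add: emeasure_distr emeasure_eq_measure ennreal_mult)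
qed

text \<open>The joint law is the product of the marginal laws, so Tonelli applies. In the iterated
  integral \<open>Y\<close> is frozen at an independent sample point \<open>\<omega>'\<close>; this
  serves as conditioning on \<open>Y\<close> in all later steps.\<close>

lemma (in prob_space) nn_integral_indep_rvs:
  assumes ind: "indep_rvs M S X T Y" and f [measurable]: "f \<in> borel_measurable (S \<Otimes>\<^sub>M T)"
  shows "(\<integral>\<^sup>+\<omega>. f (X \<omega>, Y \<omega>) \<partial>M) = (\<integral>\<^sup>+\<omega>'. \<integral>\<^sup>+\<omega>. f (X \<omega>, Y \<omega>') \<partial>M \<partial>M)"
proof -
  have [measurable]: "X \<in> measurable M S" "Y \<in> measurable M T"
    using ind by (auto simp: indep_rvs_def)
  interpret X: prob_space "distr M S X" by (rule prob_space_distr) simp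
  interpret Y: prob_space "distr M T Y" by (rule prob_space_distr) simp
  interpret pair_sigma_finite "distr M S X" "distr M T Y" ..
  have fm: "f \<in> borel_measurable (distr M S X \<Otimes>\<^sub>M distr M T Y)"
    using f by (simp cong: measurable_cong_sets sets_pair_measure_cong)
  have "(\<integral>\<^sup>+\<omega>. f (X \<omega>, Y \<omega>) \<partial>M) = (\<integral>\<^sup>+z. f z \<partial>(distr M S X \<Otimes>\<^sub>M distr M T Y))"
    by (simp add: nn_integral_distr flip: distr_indep_rvs[OF ind])
  also have "\<dots> = (\<integral>\<^sup>+y. \<integral>\<^sup>+x. f (x, y) \<partial>distr M S X \<partial>distr M T Y)"
    by (rule nn_integral_snd[OF fm, symmetric])
  also have "\<dots> = (\<integral>\<^sup>+y. \<integral>\<^sup>+\<omega>. f (X \<omega>, y) \<partial>M \<partial>distr M T Y)"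
    by (intro nn_integral_cong) (simp add: nn_integral_distr)
  also have "\<dots> = (\<integral>\<^sup>+\<omega>'. \<integral>\<^sup>+\<omega>. f (X \<omega>, Y \<omega>') \<partial>M \<partial>M)"
    by (subst nn_integral_distr) auto
  finally show ?thesis .
qed

lemma (in prob_space) indep_var_imp_indep_rvs:
  assumes "indep_var S X T Y"
  shows "indep_rvs M S X T Y"
  using assms unfolding indep_var_eq indep_rvs_def
  by (auto simp: indep_set_def intro: indep_sets_mono_sets split: bool.splits)

subsection \<open>Radial integration and Rayleigh fading\<close>

text \<open>A disc of radius \<open>sqrt u\<close> has area \<open>pi * u\<close>, so squaring the
  norm pushes planar Lebesgue measure to \<open>pi\<close> times Lebesgue measure on the half-line.
  The type is left general because the lemma is applied both to \<open>real \<times> real\<close>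
  (fading) and to \<open>real^2\<close> (positions).\<close>

lemma nn_integral_radial_2:
  fixes f :: "real \<Rightarrow> ennreal"
  assumes dim: "DIM('a::euclidean_space) = 2" and f [measurable]: "f \<in> borel_measurable borel"
  shows "(\<integral>\<^sup>+y. f ((norm (y::'a))\<^sup>2) \<partial>lborel) = ennreal pi * (\<integral>\<^sup>+u. f u * indicator {0..} u \<partial>lborel)"
proof -
  \<comment> \<open>The sign is reversed because \<open>measure_eqI_lessThan\<close> compares finite
    masses of upper rays: an upper ray for \<open>- (norm y)\<^sup>2\<close> is a disc, whereas for
    \<open>(norm y)\<^sup>2\<close> it would be the complement of one.\<close>
  let ?D = "density lborel (\<lambda>u::real. ennreal pi * indicator {..0} u)"
  have D: "emeasure ?D {x<..} = ennreal (pi * max 0 (- x))" for x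
  proof -
    have "emeasure ?D {x<..} = (\<integral>\<^sup>+u. ennreal pi * indicator {x<..0} u \<partial>lborel)"
      by (auto simp: emeasure_density intro!: nn_integral_cong split: split_indicator)
    also have "\<dots> = ennreal (pi * max 0 (- x))"
      by (cases "x \<le> 0") (auto simp: nn_integral_cmult max_def simp flip: ennreal_mult)
    finally show ?thesis .
  qed
  have N: "emeasure (distr lborel borel (\<lambda>y::'a. - (norm y)\<^sup>2)) {x<..} = ennreal (pi * max 0 (- x))" for x
  proof -
    have "(\<lambda>y::'a. - (norm y)\<^sup>2) -` {x<..} = ball 0 (sqrt (max 0 (- x)))"
    proof (cases "x < 0")
      case True
      have "norm y < sqrt (- x) \<longleftrightarrow> (norm y)\<^sup>2 < - x" for y :: 'a
        by (metis norm_ge_zero real_sqrt_less_iff real_sqrt_abs abs_norm_cancel)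
      then show ?thesis using True by auto
    next
      case False
      have "\<not> x < - (norm y)\<^sup>2" for y :: 'a
        using False zero_le_power2[of "norm y"] by linarith
      then show ?thesis using False by auto
    qed
    then show ?thesis
      by (simp add: emeasure_distr emeasure_ball dim unit_ball_vol_2)
  qed
  have eq: "distr lborel borel (\<lambda>y::'a. - (norm y)\<^sup>2) = ?D"
    by (rule measure_eqI_lessThan) (auto simp: N D)
  have "(\<integral>\<^sup>+y. f ((norm (y::'a))\<^sup>2) \<partial>lborel) = (\<integral>\<^sup>+u. f (- u) \<partial>distr lborel borel (\<lambda>y::'a. - (norm y)\<^sup>2))"
    by (simp add: nn_integral_distr)
  also have "\<dots> = (\<integral>\<^sup>+u. ennreal pi * (f (- u) * indicator {..0} u) \<partial>lborel)"
    unfolding eq by (subst nn_integral_density) (auto simp: mult_ac)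
  also have "\<dots> = ennreal pi * (\<integral>\<^sup>+u. f (- u) * indicator {..0} u \<partial>lborel)"
    by (rule nn_integral_cmult) simp
  also have "(\<integral>\<^sup>+u. f (- u) * indicator {..0} u \<partial>lborel) =
      (\<integral>\<^sup>+u. f u * indicator {0..} u \<partial>lborel)"
    by (subst nn_integral_real_affine[where c = "-1" and t = 0])
      (auto intro!: nn_integral_cong split: split_indicator)
  finally show ?thesis .
qed

text \<open>Two independent centred normal densities of variance 1/2 multiply to
  \<open>exp (- (cmod z)\<^sup>2) / pi\<close>, which is radial. Radial integration cancels
  \<open>pi\<close> and leaves the exponential density of mean 1.\<close>

lemma (in prob_space) nn_integral_circular_complex_gaussian_sq:
  assumes Z: "circular_complex_gaussian M 1 Z" and f [measurable]: "f \<in> borel_measurable borel"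
  shows "(\<integral>\<^sup>+\<omega>. f ((cmod (Z \<omega>))\<^sup>2) \<partial>M) = (\<integral>\<^sup>+u. f u * ennreal (exp (- u)) * indicator {0..} u \<partial>lborel)"
proof -
  let ?n = "normal_density 0 (sqrt (1 / 2))"
  have ind: "indep_var borel (\<lambda>\<omega>. Re (Z \<omega>)) borel (\<lambda>\<omega>. Im (Z \<omega>))"
    using Z by (simp add: circular_complex_gaussian_def)
  have D: "distributed M (lborel \<Otimes>\<^sub>M lborel) (\<lambda>\<omega>. (Re (Z \<omega>), Im (Z \<omega>))) (\<lambda>(x, y). ennreal (?n x) * ennreal (?n y))"
    using Z ind
    by (intro distributed_joint_indep)
      (auto simp: circular_complex_gaussian_def lborel.sigma_finite_measure_axioms
        indep_var_eq[where S = borel] indep_var_eq[where S = lborel])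
  have dens: "ennreal (?n x) * ennreal (?n y) = ennreal (1 / pi) * ennreal (exp (- (norm (x, y))\<^sup>2))" for x y
  proof -
    have "?n x * ?n y = 1 / pi * exp (- (norm (x, y))\<^sup>2)"
      by (simp add: normal_density_def norm_Pair exp_add[symmetric] field_simps exp_diff exp_minus)
    then show ?thesis by (simp flip: ennreal_mult)
  qed
  have "(\<integral>\<^sup>+\<omega>. f ((cmod (Z \<omega>))\<^sup>2) \<partial>M) = (\<integral>\<^sup>+\<omega>. (\<lambda>p. f ((norm p)\<^sup>2)) (Re (Z \<omega>), Im (Z \<omega>)) \<partial>M)"
    by (simp add: norm_Pair cmod_def)
  also have "\<dots> = (\<integral>\<^sup>+p. (case p of (x, y) \<Rightarrow> ennreal (?n x) * ennreal (?n y)) * f ((norm p)\<^sup>2) \<partial>(lborel \<Otimes>\<^sub>M lborel))"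
    by (rule distributed_nn_integral[OF D, symmetric]) (simp add: lborel_prod)
  also have "\<dots> = (\<integral>\<^sup>+p. (\<lambda>u. ennreal (1 / pi) * (ennreal (exp (- u)) * f u)) ((norm (p::real \<times> real))\<^sup>2) \<partial>lborel)"
    unfolding lborel_prod by (intro nn_integral_cong) (auto simp: dens mult_ac split: prod.split)
  also have "\<dots> = ennreal pi * (\<integral>\<^sup>+u. ennreal (1 / pi) * (ennreal (exp (- u)) * f u) * indicator {0..} u \<partial>lborel)"
    by (rule nn_integral_radial_2) auto
  also have "\<dots> = ennreal pi * (ennreal (1 / pi) * (\<integral>\<^sup>+u. f u * ennreal (exp (- u)) * indicator {0..} u \<partial>lborel))"
    by (subst nn_integral_cmult[symmetric]) (auto simp: mult_ac)
  also have "\<dots> = (\<integral>\<^sup>+u. f u * ennreal (exp (- u)) * indicator {0..} u \<partial>lborel)"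
    by (simp add: mult.assoc[symmetric] flip: ennreal_mult)
  finally show ?thesis .
qed

lemma nn_integral_exp_minus_atLeast:
  assumes "c > 0"
  shows "(\<integral>\<^sup>+u. ennreal (exp (- (c * u))) * indicator {a..} u \<partial>lborel) = ennreal (exp (- (c * a)) / c)"
proof -
  have "(\<integral>\<^sup>+u. ennreal (exp (- (c * u))) * indicator {a..} u \<partial>lborel) = ennreal (0 - (- exp (- (c * a)) / c))"
  proof (rule nn_integral_FTC_atLeast)
    show "((\<lambda>u. - exp (- (c * u)) / c) \<longlongrightarrow> 0) at_top"
      using assms by real_asymp
  qed (use assms in \<open>auto intro!: derivative_eq_intros\<close>)
  then show ?thesis by simp
qed

lemma (in prob_space) tail_circular_complex_gaussian_sq:
  assumes Z: "circular_complex_gaussian M 1 Z" and a: "a \<ge> 0"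
  shows "emeasure M {\<omega> \<in> space M. a \<le> (cmod (Z \<omega>))\<^sup>2} = ennreal (exp (- a))"
proof -
  have "(\<lambda>\<omega>. Re (Z \<omega>)) \<in> borel_measurable M" "(\<lambda>\<omega>. Im (Z \<omega>)) \<in> borel_measurable M"
    using Z by (auto simp: circular_complex_gaussian_def indep_var_eq)
  then have [measurable]: "(\<lambda>\<omega>. (cmod (Z \<omega>))\<^sup>2) \<in> borel_measurable M"
    by (simp add: cmod_power2)
  have "emeasure M {\<omega> \<in> space M. a \<le> (cmod (Z \<omega>))\<^sup>2} = (\<integral>\<^sup>+\<omega>. indicator {a..} ((cmod (Z \<omega>))\<^sup>2) \<partial>M)"
    by (subst nn_integral_indicator[symmetric], measurable, rule nn_integral_cong)
      (auto split: split_indicator)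
  also have "\<dots> = (\<integral>\<^sup>+u. indicator {a..} u * ennreal (exp (- u)) * indicator {0..} u \<partial>lborel)"
    by (rule nn_integral_circular_complex_gaussian_sq[OF Z]) simp
  also have "\<dots> = (\<integral>\<^sup>+u. ennreal (exp (- (1 * u))) * indicator {a..} u \<partial>lborel)"
    using a by (intro nn_integral_cong) (auto split: split_indicator)
  also have "\<dots> = ennreal (exp (- a))"
    by (subst nn_integral_exp_minus_atLeast) simp_all
  finally show ?thesis .
qed

text \<open>The Laplace transform of the exponential law of mean 1. Each interferer contributes one
  such factor to the tail of the SINR.\<close>

lemma (in prob_space) laplace_circular_complex_gaussian_sq:
  assumes Z: "circular_complex_gaussian M 1 Z" and b: "b \<ge> 0"
  shows "(\<integral>\<^sup>+\<omega>. ennreal (exp (- (b * (cmod (Z \<omega>))\<^sup>2))) \<partial>M) = ennreal (1 / (1 + b))"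
proof -
  have "(\<integral>\<^sup>+\<omega>. ennreal (exp (- (b * (cmod (Z \<omega>))\<^sup>2))) \<partial>M) =
      (\<integral>\<^sup>+u. ennreal (exp (- (b * u))) * ennreal (exp (- u)) * indicator {0..} u \<partial>lborel)"
    by (rule nn_integral_circular_complex_gaussian_sq[OF Z, where f = "\<lambda>u. ennreal (exp (- (b * u)))"]) simp
  also have "\<dots> = (\<integral>\<^sup>+u. ennreal (exp (- ((1 + b) * u))) * indicator {0..} u \<partial>lborel)"
    by (intro nn_integral_cong) (auto simp: algebra_simps exp_add[symmetric] simp flip: ennreal_mult split: split_indicator)
  also have "\<dots> = ennreal (1 / (1 + b))"
    using b by (subst nn_integral_exp_minus_atLeast) simp_all
  finally show ?thesis .
qed

subsection \<open>The Laplace functional of a Poisson process\<close>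

text \<open>The probability generating function of the Poisson law, summed by the exponential
  series. With \<open>0 ^ 0 = 1\<close> it covers rate 0 as well as \<open>c = 0\<close>; the latter
  arises where \<psi> takes the value 1.\<close>

lemma (in prob_space) expectation_power_poisson:
  assumes N [measurable]: "N \<in> measurable M (count_space UNIV)"
    and p: "\<And>n. prob {\<omega> \<in> space M. N \<omega> = n} = l ^ n / fact n * exp (- l)"
    and l: "l \<ge> 0" and c: "c \<ge> (0::real)"
  shows "expectation (\<lambda>\<omega>. c ^ N \<omega>) = exp (- ((1 - c) * l))"
proof -
  let ?p = "\<lambda>n. l ^ n / fact n * exp (- l)"
  have D: "distr M (count_space UNIV) N = density (count_space UNIV) (\<lambda>n. ennreal (?p n))"
  proof (rule measure_eqI_countable[where A = UNIV])
    fix n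
    have "emeasure (distr M (count_space UNIV) N) {n} = ennreal (?p n)"
      using p[of n] by (simp add: emeasure_distr emeasure_eq_measure vimage_def Int_def conj_commute)
    moreover have "emeasure (density (count_space UNIV) (\<lambda>n. ennreal (?p n))) {n} = ennreal (?p n)"
      by (simp add: emeasure_density nn_integral_count_space_indicator[symmetric] nn_integral_count_space_finite)
    ultimately show "emeasure (distr M (count_space UNIV) N) {n} =
        emeasure (density (count_space UNIV) (\<lambda>n. ennreal (?p n))) {n}" by simp
  qed auto
  have "(\<integral>\<^sup>+\<omega>. ennreal (c ^ N \<omega>) \<partial>M) = (\<integral>\<^sup>+n. ennreal (c ^ n) \<partial>distr M (count_space UNIV) N)"
    by (simp add: nn_integral_distr)
  also have "\<dots> = (\<Sum>n. ennreal (?p n) * ennreal (c ^ n))"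
    by (simp add: D nn_integral_density nn_integral_count_space_nat)
  also have "\<dots> = (\<Sum>n. ennreal (?p n * c ^ n))"
    using l c by (intro suminf_cong ennreal_mult[symmetric]) auto
  also have "\<dots> = ennreal (exp (- ((1 - c) * l)))"
  proof (rule suminf_ennreal_eq)
    have "(\<lambda>n. exp (- l) * ((c * l) ^ n /\<^sub>R fact n)) sums (exp (- l) * exp (c * l))"
      by (intro sums_mult exp_converges)
    then show "(\<lambda>n. ?p n * c ^ n) sums exp (- ((1 - c) * l))"
      by (simp add: exp_add[symmetric] power_mult_distrib field_simps)
  qed (use l c in auto)
  finally show ?thesis
    by (intro integral_eq_nn_integral[THEN trans]) (use c in auto)
qed

lemma prod_if_eq_power_card:
  fixes c :: "'a::comm_monoid_mult"
  assumes "finite A"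
  shows "(\<Prod>k\<in>A. if P k then c else 1) = c ^ card {k\<in>A. P k}"
  using assms by (simp add: prod.inter_filter[symmetric])

text \<open>If \<psi> takes the nonzero values \<open>v i\<close> on the disjoint sets
  \<open>B i\<close>, the product over all points is the product of \<open>(1 - v i) ^ N i\<close>,
  where the counts \<open>N i\<close> are independent and Poisson. Their generating functions
  multiply to the exponential of minus the integral. The enumeration never ends, hence the limit of
  partial products.\<close>

lemma (in prob_space) poisson_laplace_functional_simple:
  assumes X: "poisson_point_process M \<Lambda> X"
    and \<psi>: "simple_function \<Lambda> \<psi>" "integrable \<Lambda> \<psi>" "\<And>y. 0 \<le> \<psi> y" "\<And>y. \<psi> y \<le> (1::real)"
  shows "(\<lambda>n. expectation (\<lambda>\<omega>. \<Prod>k<n. 1 - \<psi> (X k \<omega>))) \<longlonglongrightarrow> exp (- integral\<^sup>L \<Lambda> \<psi>)"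
proof -
  \<comment> \<open>The value 0 is left out: its level set may have infinite measure, and points in
    it contribute the factor 1.\<close>
  define V where "V = \<psi> ` space \<Lambda> - {0}"
  have "finite V"
    using \<psi>(1) by (simp add: V_def simple_function_def)
  then obtain v where v: "bij_betw v {..<card V} V"
    using ex_bij_betw_nat_finite[of V] by (auto simp: atLeast0LessThan)
  define m where "m = card V"
  define B where "B i = \<psi> -` {v i} \<inter> space \<Lambda>" for i
  define N where "N i \<omega> = card {k. X k \<omega> \<in> B i}" for i \<omega>
  have [measurable]: "\<psi> \<in> borel_measurable \<Lambda>" "\<And>k. X k \<in> measurable M \<Lambda>"
    using \<psi>(2) X by (auto simp: poisson_point_process_def)
  have [measurable]: "B i \<in> sets \<Lambda>" for i
    unfolding B_def by measurable
  have v0: "v i \<noteq> 0" "0 \<le> v i" "v i \<le> 1" if "i < m" for i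
    using bij_betw_apply[OF v, of i] that \<psi>(3,4) by (auto simp: V_def m_def)
  have fin: "emeasure \<Lambda> (B i) < \<infinity>" if "i < m" for i
  proof -
    have "(\<integral>\<^sup>+x. ennreal (\<psi> x) \<partial>\<Lambda>) < \<infinity>"
      using \<psi>(2,3) by (simp add: integrable_iff_bounded)
    then have "emeasure \<Lambda> {y\<in>space \<Lambda>. ennreal (\<psi> y) \<noteq> 0} \<noteq> \<infinity>"
      by (intro simple_function_finite_support simple_function_compose1[OF \<psi>(1)]) auto
    moreover have "emeasure \<Lambda> (B i) \<le> emeasure \<Lambda> {y\<in>space \<Lambda>. ennreal (\<psi> y) \<noteq> 0}"
      using v0[OF that] by (intro emeasure_mono) (auto simp: B_def)
    ultimately show ?thesis by (auto simp: top.not_eq_extremum)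
  qed
  have inj: "v i = v j \<longleftrightarrow> i = j" if "i < m" "j < m" for i j
    using v that by (auto simp: bij_betw_def inj_on_def m_def)
  have disj: "disjoint_family_on B {..<m}"
    using inj by (auto simp: disjoint_family_on_def B_def)
  \<comment> \<open>At most one factor differs from 1. This is used with \<open>g t = 1 - t\<close>
    for the points of the process and with \<open>g = exp\<close> for the integral of
    \<psi>.\<close>
  have repr: "g (\<psi> y) = (\<Prod>i<m. if y \<in> B i then g (v i) else 1)"
    if g: "g 0 = 1" and y: "y \<in> space \<Lambda>" for g :: "real \<Rightarrow> real" and y
  proof (cases "\<psi> y = 0")
    case True
    then have "y \<notin> B i" if "i < m" for i using v0[OF that] by (auto simp: B_def)
    then show ?thesis using True g by (auto intro!: prod.neutral[symmetric])
  next
    case False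
    then have "\<psi> y \<in> V" using y by (auto simp: V_def)
    then obtain j where j: "j < m" "v j = \<psi> y"
      using v unfolding m_def by (metis bij_betw_imp_surj_on imageE lessThan_iff)
    have "(\<Prod>i<m. if y \<in> B i then g (v i) else 1) = (\<Prod>i<m. if i = j then g (v j) else 1)"
      using j y inj by (intro prod.cong) (auto simp: B_def)
    then show ?thesis using j by simp
  qed
  have ind: "indep_vars (\<lambda>_. count_space UNIV) N {..<m}"
    using X fin disj unfolding poisson_point_process_def N_def by auto
  then have [measurable]: "N i \<in> measurable M (count_space UNIV)" if "i < m" for i
    using that by (auto simp: indep_vars_def)
  have ind': "indep_vars (\<lambda>_. borel) (\<lambda>i \<omega>. (1 - v i) ^ N i \<omega>) {..<m}"
    by (rule indep_vars_compose2[OF ind]) simp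
  have le1: "\<bar>1 - v i\<bar> ^ k \<le> 1" if "i < m" for i k
    using v0[OF that] by (intro power_le_one) auto
  have int: "integrable M (\<lambda>\<omega>. (1 - v i) ^ N i \<omega>)" if "i < m" for i
    using that le1[OF that] by (intro integrable_const_bound[where B = 1]) (auto simp: power_abs)
  have pN: "prob {\<omega>\<in>space M. N i \<omega> = n} = measure \<Lambda> (B i) ^ n / fact n * exp (- measure \<Lambda> (B i))"
    if "i < m" for i n
    using X fin[OF that] unfolding poisson_point_process_def N_def by auto
  have finAE: "AE \<omega> in M. \<forall>i<m. finite {k. X k \<omega> \<in> B i}"
  proof -
    have "AE \<omega> in M. finite {k. X k \<omega> \<in> B i}" if "i < m" for i
      using X fin[OF that] unfolding poisson_point_process_def by auto
    then have "AE \<omega> in M. \<forall>i\<in>{..<m}. finite {k. X k \<omega> \<in> B i}"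
      by (intro AE_finite_allI) auto
    then show ?thesis by (simp only: Ball_def lessThan_iff)
  qed

  have "(\<lambda>n. expectation (\<lambda>\<omega>. \<Prod>k<n. 1 - \<psi> (X k \<omega>))) \<longlonglongrightarrow>
      expectation (\<lambda>\<omega>. \<Prod>i<m. (1 - v i) ^ N i \<omega>)"
  proof (rule integral_dominated_convergence[where w = "\<lambda>_. 1"])
    show "AE \<omega> in M. (\<lambda>n. \<Prod>k<n. 1 - \<psi> (X k \<omega>)) \<longlonglongrightarrow> (\<Prod>i<m. (1 - v i) ^ N i \<omega>)"
      using finAE AE_space
    proof eventually_elim
      case (elim \<omega>)
      have "(\<lambda>n. (1 - v i) ^ card {k\<in>{..<n}. X k \<omega> \<in> B i}) \<longlonglongrightarrow> (1 - v i) ^ N i \<omega>" if "i < m" for i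
      proof (rule tendsto_eventually)
        \<comment> \<open>Only finitely many indices hit \<open>B i\<close>, so beyond some
          \<open>K\<close> the count over the first \<open>n\<close> points is already the full
          count.\<close>
        have "finite {k. X k \<omega> \<in> B i}"
          using elim(1) that by simp
        then obtain K where "\<forall>k\<in>{k. X k \<omega> \<in> B i}. k < K"
          unfolding finite_nat_set_iff_bounded by (rule exE)
        then show "eventually (\<lambda>n. (1 - v i) ^ card {k\<in>{..<n}. X k \<omega> \<in> B i} = (1 - v i) ^ N i \<omega>) sequentially"
          unfolding N_def
          by (intro eventually_sequentiallyI[of K] arg_cong[where f = "\<lambda>A. (1 - v i) ^ card A"]) auto
      qed
      then have "(\<lambda>n. \<Prod>i<m. (1 - v i) ^ card {k\<in>{..<n}. X k \<omega> \<in> B i}) \<longlonglongrightarrow> (\<Prod>i<m. (1 - v i) ^ N i \<omega>)"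
        by (intro tendsto_prod) auto
      moreover have "(\<Prod>k<n. 1 - \<psi> (X k \<omega>)) = (\<Prod>i<m. (1 - v i) ^ card {k\<in>{..<n}. X k \<omega> \<in> B i})" for n
      proof -
        have "X k \<omega> \<in> space \<Lambda>" for k
          using elim(2) by (rule measurable_space[rotated]) measurable
        then have "(\<Prod>k<n. 1 - \<psi> (X k \<omega>)) = (\<Prod>k<n. \<Prod>i<m. if X k \<omega> \<in> B i then 1 - v i else 1)"
          using repr[of "\<lambda>t. 1 - t"] by simp
        also have "\<dots> = (\<Prod>i<m. \<Prod>k<n. if X k \<omega> \<in> B i then 1 - v i else 1)"
          by (rule prod.swap)
        finally show ?thesis by (simp only: prod_if_eq_power_card finite_lessThan)
      qed
      ultimately show ?case by simp
    qed
    show "AE \<omega> in M. norm (\<Prod>k<n. 1 - \<psi> (X k \<omega>)) \<le> 1" for n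
      using \<psi>(3,4) by (auto intro!: prod_le_1 simp: abs_prod)
  qed auto
  also have "expectation (\<lambda>\<omega>. \<Prod>i<m. (1 - v i) ^ N i \<omega>) = (\<Prod>i<m. exp (- (v i * measure \<Lambda> (B i))))"
  proof -
    have "expectation (\<lambda>\<omega>. \<Prod>i<m. (1 - v i) ^ N i \<omega>) = (\<Prod>i<m. expectation (\<lambda>\<omega>. (1 - v i) ^ N i \<omega>))"
      by (rule indep_vars_lebesgue_integral) (use ind' int in auto)
    also have "\<dots> = (\<Prod>i<m. exp (- (v i * measure \<Lambda> (B i))))"
    proof (rule prod.cong[OF refl])
      fix i assume "i \<in> {..<m}"
      then have "i < m" by simp
      from expectation_power_poisson[OF _ pN[OF this], of "1 - v i"] this v0[OF this]
      show "expectation (\<lambda>\<omega>. (1 - v i) ^ N i \<omega>) = exp (- (v i * measure \<Lambda> (B i)))" by simp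
    qed
    finally show ?thesis .
  qed
  also have "\<dots> = exp (- (\<Sum>i<m. v i * measure \<Lambda> (B i)))"
    by (simp add: exp_sum sum_negf[symmetric])
  also have "(\<Sum>i<m. v i * measure \<Lambda> (B i)) = integral\<^sup>L \<Lambda> \<psi>"
  proof -
    have "integral\<^sup>L \<Lambda> \<psi> = (\<integral>y. (\<Sum>i<m. v i * indicator (B i) y) \<partial>\<Lambda>)"
    proof (rule Bochner_Integration.integral_cong[OF refl])
      fix y assume y: "y \<in> space \<Lambda>"
      \<comment> \<open>The exponential turns the product representation into a sum, and its
        injectivity then gives the representation of \<psi> itself.\<close>
      have "exp (\<psi> y) = (\<Prod>i<m. if y \<in> B i then exp (v i) else 1)"
        by (rule repr) (use y in auto)
      also have "\<dots> = (\<Prod>i<m. exp (v i * indicator (B i) y))"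
        by (intro prod.cong) auto
      also have "\<dots> = exp (\<Sum>i<m. v i * indicator (B i) y)"
        by (rule exp_sum[symmetric]) simp
      finally show "\<psi> y = (\<Sum>i<m. v i * indicator (B i) y)" by simp
    qed
    also have "\<dots> = (\<Sum>i<m. v i * measure \<Lambda> (B i))"
      using fin by (subst Bochner_Integration.integral_sum) (auto simp: sets.Int_space_eq2)
    finally show ?thesis ..
  qed
  finally show ?thesis .
qed

text \<open>
  If \<open>a\<close> is the claimed limit and \<open>a\<^sub>j\<close> its analogue for the simple function \<open>s\<^sub>j \<up> \<psi>\<close>, then the
  expectation over the first \<open>n\<close> points lies between \<open>a\<close> and a sequence converging to \<open>a\<^sub>j\<close>, for each \<open>j\<close>.
\<close>
lemma (in prob_space) poisson_laplace_functional:
  fixes \<Lambda> :: "'b measure"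
  assumes X: "poisson_point_process M \<Lambda> X"
    and \<psi>: "integrable \<Lambda> \<psi>" "\<And>y. 0 \<le> \<psi> y" "\<And>y. \<psi> y \<le> (1::real)"
  shows "(\<lambda>n. expectation (\<lambda>\<omega>. \<Prod>k<n. 1 - \<psi> (X k \<omega>))) \<longlonglongrightarrow> exp (- integral\<^sup>L \<Lambda> \<psi>)"
proof -
  have [measurable]: "\<psi> \<in> borel_measurable \<Lambda>" "\<And>k. X k \<in> measurable M \<Lambda>"
    using \<psi>(1) X by (auto simp: poisson_point_process_def)
  obtain s where s: "incseq s" "\<And>j. simple_function \<Lambda> (s j)" "\<And>y. bdd_above (range (\<lambda>j. s j y))"
      "\<And>j y. 0 \<le> s j y" "\<psi> = (SUP j. s j)"
    using borel_measurable_implies_simple_function_sequence_real[of \<psi> \<Lambda>] \<psi>(2) by auto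
  have inc: "incseq (\<lambda>j. s j y)" for y
    using s(1) by (auto simp: incseq_def le_fun_def)
  have SUP: "\<psi> y = (SUP j. s j y)" for y
    using s(5) by (metis SUP_apply)
  have lim: "(\<lambda>j. s j y) \<longlonglongrightarrow> \<psi> y" for y
    unfolding SUP by (rule LIMSEQ_incseq_SUP[OF s(3) inc])
  have le: "s j y \<le> \<psi> y" for j y
    by (rule incseq_le[OF inc lim])
  have le1: "s j y \<le> 1" for j y
    using le \<psi>(3) order_trans by blast
  have [measurable]: "s j \<in> borel_measurable \<Lambda>" for j
    using s(2) by (rule borel_measurable_simple_function)
  have int: "integrable \<Lambda> (s j)" for j
    by (rule Bochner_Integration.integrable_bound[OF \<psi>(1)]) (simp_all add: le \<psi>(2) s(4))
  have bound: "\<bar>\<Prod>k<n. 1 - f (X k \<omega>)\<bar> \<le> 1" if "\<And>y. 0 \<le> f y" "\<And>y. f y \<le> 1" for f :: "_ \<Rightarrow> real" and n \<omega>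
    using that by (auto intro!: prod_le_1 simp: abs_prod)
  have intM: "integrable M (\<lambda>\<omega>. \<Prod>k<n. 1 - f (X k \<omega>))"
    if "\<And>y. 0 \<le> f y" "\<And>y. f y \<le> 1" "f \<in> borel_measurable \<Lambda>" for f :: "_ \<Rightarrow> real" and n
    using that(3) by (intro integrable_const_bound[where B = 1]) (simp_all add: bound that(1,2))
  define E :: "('b \<Rightarrow> real) \<Rightarrow> nat \<Rightarrow> real"
    where "E f n = expectation (\<lambda>\<omega>. \<Prod>k<n. 1 - f (X k \<omega>))" for f n
  have Es: "E (s j) \<longlonglongrightarrow> exp (- integral\<^sup>L \<Lambda> (s j))" for j
    unfolding E_def by (rule poisson_laplace_functional_simple[OF X s(2) int s(4) le1])
  have E_le: "E \<psi> n \<le> E (s j) n" for j n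
    unfolding E_def
    by (intro integral_mono prod_mono intM) (use le \<psi>(2,3) le1 s(4) in auto)
  have dec: "decseq (E (s j))" for j
    unfolding E_def
    by (rule decseq_SucI, intro integral_mono intM)
      (use le1 s(4) in \<open>auto intro!: mult_left_le prod_nonneg\<close>)
  \<comment> \<open>Fix \<open>n\<close> and let \<open>j\<close> tend to infinity. Each
    \<open>E (s j) n\<close> is at least its limit in \<open>n\<close>, because the sequence
    decreases, and that limit is at least the claimed one, because \<open>s j\<close> lies below
    \<psi>.\<close>
  have le_E: "exp (- integral\<^sup>L \<Lambda> \<psi>) \<le> E \<psi> n" for n
  proof (rule LIMSEQ_le_const)
    show "(\<lambda>j. E (s j) n) \<longlonglongrightarrow> E \<psi> n"
      unfolding E_def
    proof (rule integral_dominated_convergence[where w = "\<lambda>_. 1"])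
      show "AE \<omega> in M. (\<lambda>j. \<Prod>k<n. 1 - s j (X k \<omega>)) \<longlonglongrightarrow> (\<Prod>k<n. 1 - \<psi> (X k \<omega>))"
        by (intro AE_I2 tendsto_intros lim)
    qed (use bound s(4) le1 in auto)
    have "exp (- integral\<^sup>L \<Lambda> \<psi>) \<le> E (s j) n" for j
    proof -
      have "exp (- integral\<^sup>L \<Lambda> \<psi>) \<le> exp (- integral\<^sup>L \<Lambda> (s j))"
        using integral_mono[OF int \<psi>(1) le] by simp
      also have "\<dots> \<le> E (s j) n"
        by (rule decseq_ge[OF dec Es])
      finally show ?thesis .
    qed
    then show "\<exists>J. \<forall>j\<ge>J. exp (- integral\<^sup>L \<Lambda> \<psi>) \<le> E (s j) n" by blast
  qed
  have "(\<lambda>j. integral\<^sup>L \<Lambda> (s j)) \<longlonglongrightarrow> integral\<^sup>L \<Lambda> \<psi>"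
    by (rule integral_dominated_convergence[where w = \<psi>]) (use \<psi> lim le s(4) in auto)
  then have a: "(\<lambda>j. exp (- integral\<^sup>L \<Lambda> (s j))) \<longlonglongrightarrow> exp (- integral\<^sup>L \<Lambda> \<psi>)"
    by (intro tendsto_intros)
  have "E \<psi> \<longlonglongrightarrow> exp (- integral\<^sup>L \<Lambda> \<psi>)"
  proof (rule order_tendstoI)
    fix c assume "c < exp (- integral\<^sup>L \<Lambda> \<psi>)"
    then show "\<forall>\<^sub>F n in sequentially. c < E \<psi> n"
      using le_E by (intro always_eventually allI) (rule less_le_trans)
  next
    fix c assume "exp (- integral\<^sup>L \<Lambda> \<psi>) < c"
    \<comment> \<open>Some \<open>j\<close> already has its limit below \<open>c\<close>, and
      \<open>E \<psi> n\<close> is at most \<open>E (s j) n\<close>.\<close>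
    from order_tendstoD(2)[OF a this] obtain j where "exp (- integral\<^sup>L \<Lambda> (s j)) < c"
      by (auto simp: eventually_sequentially)
    from order_tendstoD(2)[OF Es this] show "\<forall>\<^sub>F n in sequentially. E \<psi> n < c"
      by eventually_elim (use E_le le_less_trans in blast)
  qed
  then show ?thesis by (simp add: E_def[abs_def])
qed

subsection \<open>Euler's integral and the path loss\<close>

lemma continuous_on_euler_integrand:
  fixes t b :: real
  assumes "t \<ge> 0" "b > 0"
  shows "continuous_on {0..} (\<lambda>w::real. 1 / (1 + t * w powr (1 / b)))"
proof -
  have "1 + t * w powr (1 / b) > 0" for w :: real
    using assms by (intro add_pos_nonneg) auto
  then have "1 + t * w powr (1 / b) \<noteq> 0" for w :: real
    by (metis less_irrefl)
  moreover have "continuous_on {0..} (\<lambda>w::real. w powr (1 / b))"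
    by (rule continuous_on_powr') (use assms in \<open>auto intro!: continuous_intros\<close>)
  ultimately show ?thesis
    by (intro continuous_on_divide continuous_on_add continuous_on_mult continuous_on_const) auto
qed

text \<open>The point \<open>- t\<close> lies off the cut, so the hypergeometric value is Euler's
  integral. Its integrand is real there, and the real part is the whole value.\<close>

lemma Re_hyp2F1_euler_integral:
  assumes t: "t \<ge> 0" and b: "b > 0"
  shows "Re (hyp2F1 1 (of_real b) (of_real (b + 1)) (of_real (- t))) =
    integral {0..1} (\<lambda>w. 1 / (1 + t * w powr (1 / b)))"
proof -
  have "complex_of_real (- t) \<in> slit_plane"
    using t by (auto simp: complex_slot_right_eq)
  then have "hyp2F1 1 (of_real b) (of_real (b + 1)) (of_real (- t)) = euler_2F1 b (of_real (- t))"
    by (rule hyp2F1_eqI[OF is_hyp2F1_euler[OF b]])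
  moreover have "(\<lambda>w. 1 / (1 + t * w powr (1 / b))) integrable_on {0..1}"
    by (intro integrable_continuous_real continuous_on_subset[OF continuous_on_euler_integrand[OF t b]]) auto
  then have "((\<lambda>w. complex_of_real (1 / (1 + t * w powr (1 / b)))) has_integral
      of_real (integral {0..1} (\<lambda>w. 1 / (1 + t * w powr (1 / b))))) {0..1}"
    by (intro has_integral_of_real integrable_integral)
  then have "((\<lambda>w. 1 / (1 - of_real (- t) * complex_of_real (w powr (1 / b)))) has_integral
      of_real (integral {0..1} (\<lambda>w. 1 / (1 + t * w powr (1 / b))))) {0..1}"
    by simp
  then have "euler_2F1 b (of_real (- t)) = of_real (integral {0..1} (\<lambda>w. 1 / (1 + t * w powr (1 / b))))"
    by (simp add: euler_2F1_def integral_unique)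
  ultimately show ?thesis by simp
qed

text \<open>This is Euler's integral for \<open>b = 1 / 2\<close>, the value of
  \<open>1 - 2 / \<eta>\<close> at \<open>\<eta> = 4\<close>; the antiderivative is an
  arctangent.\<close>

lemma euler_integral_half:
  assumes t: "t > 0"
  shows "integral {0..1} (\<lambda>w. 1 / (1 + t * w powr 2)) = arctan (sqrt t) / sqrt t"
proof -
  have "((\<lambda>w. 1 / (1 + t * w powr 2)) has_integral
      arctan (sqrt t * 1) / sqrt t - arctan (sqrt t * 0) / sqrt t) {0..1}"
  proof (rule fundamental_theorem_of_calculus)
    fix w :: real assume w: "w \<in> {0..1}"
    have "((\<lambda>w. arctan (sqrt t * w) / sqrt t) has_real_derivative
        (inverse (1 + (sqrt t * w)\<^sup>2) * sqrt t) / sqrt t) (at w within {0..1})"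
      by (intro DERIV_cdivide DERIV_chain2[OF DERIV_arctan] DERIV_cmult_Id)
    moreover have "(inverse (1 + (sqrt t * w)\<^sup>2) * sqrt t) / sqrt t = 1 / (1 + t * w powr 2)"
    proof -
      have "(sqrt t * w)\<^sup>2 = t * w powr 2" "sqrt t \<noteq> 0"
        using t w by (simp_all add: power_mult_distrib)
      then show ?thesis by (simp only: inverse_eq_divide) simp
    qed
    ultimately show "((\<lambda>w. arctan (sqrt t * w) / sqrt t) has_vector_derivative
        1 / (1 + t * w powr 2)) (at w within {0..1})"
      by (simp add: has_real_derivative_iff_has_vector_derivative)
  qed simp
  then show ?thesis by (simp add: integral_unique)
qed

text \<open>
  The substitution \<open>w = (u / c)\<^sup>1\<^sup>-\<^sup>\<eta>\<^sup>/\<^sup>2\<close> turns the right tail into the unit interval.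
\<close>
lemma nn_integral_path_loss_tail:
  fixes c t \<eta> :: real
  assumes c: "c > 0" and t: "t \<ge> 0" and \<eta>: "\<eta> > 2"
  defines "g \<equiv> \<lambda>w. 1 / (1 + t * w powr (1 / (1 - 2 / \<eta>)))"
  shows "(\<integral>\<^sup>+u. ennreal (1 - 1 / (1 + t * (u / c) powr (- (\<eta> / 2)))) * indicator {c..} u \<partial>lborel) =
    ennreal (2 * t * c / (\<eta> - 2) * integral {0..1} g)"
proof -
  \<comment> \<open>The exponent in \<open>w = (u / c) powr (- a)\<close>, chosen so that
    differentiation produces the power \<open>- a - 1 = - (\<eta> / 2)\<close>.\<close>
  define a where "a = (\<eta> - 2) / 2"
  have a: "a > 0" using \<eta> by (simp add: a_def)
  \<comment> \<open>The interval reaches beyond 1 so that \<open>G\<close> has a two-sided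
    derivative at \<open>w = 1\<close>, the image of the endpoint \<open>u = c\<close>.\<close>
  have cont: "continuous_on {0..2} g"
    unfolding g_def
    by (rule continuous_on_subset[OF continuous_on_euler_integrand]) (use t \<eta> in auto)
  define G where "G w = integral {0..w} g" for w
  have G: "(G has_real_derivative g w) (at w)" if "0 < w" "w < 2" for w
    using integral_has_real_derivative[OF cont, of w] that
    unfolding G_def by (simp add: at_within_Icc_at)
  define F where "F u = - (t * c / a) * G ((u / c) powr (- a))" for u
  have "(\<integral>\<^sup>+u. ennreal (1 - 1 / (1 + t * (u / c) powr (- (\<eta> / 2)))) * indicator {c..} u \<partial>lborel) = ennreal (0 - F c)"
  proof (rule nn_integral_FTC_atLeast)
    fix u :: real assume u: "c \<le> u"
    define w where "w = (u / c) powr (- a)"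
    have pos: "1 + t * (u / c) powr (- (\<eta> / 2)) > 0"
      using t by (intro add_pos_nonneg) auto
    have "1 \<le> u / c" using u c by simp
    then have "w \<le> 1" "u / c \<noteq> 0"
      using a powr_mono[of "- a" 0 "u / c"] by (auto simp: w_def split: if_splits)
    then have w: "0 < w" "w < 2"
      by (simp_all add: w_def)
    have "((\<lambda>u. (u / c) powr (- a)) has_real_derivative - a * (u / c) powr (- a - of_nat 1) * (1 / c)) (at u)"
      using \<open>1 \<le> u / c\<close> by (intro DERIV_fun_powr DERIV_cdivide DERIV_ident) linarith
    then have "(F has_real_derivative - (t * c / a) * (g w * (- a * (u / c) powr (- a - of_nat 1) * (1 / c)))) (at u)"
      unfolding F_def w_def by (intro DERIV_cmult DERIV_chain2[where f = G]) (use G[OF w] in \<open>simp_all add: w_def\<close>)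
    also have "- (t * c / a) * (g w * (- a * (u / c) powr (- a - of_nat 1) * (1 / c))) =
        t * (u / c) powr (- (\<eta> / 2)) * g w"
    proof -
      have "- a - of_nat 1 = - (\<eta> / 2)" by (simp add: a_def field_simps)
      then show ?thesis using a c by simp
    qed
    also have "g w = 1 / (1 + t * (u / c) powr (- (\<eta> / 2)))"
    proof -
      have "- a * (1 / (1 - 2 / \<eta>)) = - (\<eta> / 2)"
        using \<eta> by (simp add: a_def field_simps)
      then show ?thesis by (simp only: g_def w_def powr_powr)
    qed
    also have "t * (u / c) powr (- (\<eta> / 2)) * (1 / (1 + t * (u / c) powr (- (\<eta> / 2)))) =
        1 - 1 / (1 + t * (u / c) powr (- (\<eta> / 2)))"
      using pos by (simp add: field_simps)
    finally show "(F has_real_derivative 1 - 1 / (1 + t * (u / c) powr (- (\<eta> / 2)))) (at u)" .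
    show "0 \<le> 1 - 1 / (1 + t * (u / c) powr (- (\<eta> / 2)))"
      using pos t by simp
  next
    have "((\<lambda>u. (u / c) powr (- a)) \<longlongrightarrow> 0) at_top"
      using a c by real_asymp
    \<comment> \<open>As \<open>u\<close> tends to infinity, \<open>w\<close> tends to 0, an
      endpoint of \<open>{0..2}\<close>. The limit of \<open>G\<close> is taken within this
      interval, so \<open>w\<close> must eventually lie in it and differ from 0.\<close>
    moreover have Glim: "(G \<longlongrightarrow> G 0) (at 0 within {0..2})"
    proof -
      have "(G has_real_derivative g 0) (at 0 within {0..2})"
        unfolding G_def by (rule integral_has_real_derivative[OF cont]) simp
      from DERIV_continuous[OF this] show ?thesis by (simp add: continuous_within)
    qed
    moreover have "\<forall>\<^sub>F u in at_top. (u / c) powr (- a) \<in> {0..2} \<and> (u / c) powr (- a) \<noteq> 0"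
    proof (rule eventually_at_top_linorderI[of c])
      fix u assume "c \<le> u"
      then have "1 \<le> u / c" using c by simp
      then have "(u / c) powr (- a) \<le> 1" "u / c \<noteq> 0" using a powr_mono[of "- a" 0 "u / c"] by (auto split: if_splits)
      then show "(u / c) powr (- a) \<in> {0..2} \<and> (u / c) powr (- a) \<noteq> 0" by simp
    qed
    ultimately have "filterlim (\<lambda>u. (u / c) powr (- a)) (at 0 within {0..2}) at_top"
      by (simp only: filterlim_at)
    then have "((\<lambda>u. G ((u / c) powr (- a))) \<longlongrightarrow> G 0) at_top"
      by (rule filterlim_compose[OF Glim])
    then have "(F \<longlongrightarrow> - (t * c / a) * G 0) at_top"
      unfolding F_def by (intro tendsto_intros)
    then show "(F \<longlongrightarrow> 0) at_top" by (simp add: G_def)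
  qed simp
  also have "0 - F c = 2 * t * c / (\<eta> - 2) * integral {0..1} g"
    using c \<eta> by (simp add: F_def G_def a_def field_simps)
  finally show ?thesis .
qed

text \<open>The integrand takes values between 0 and 1. The lower bound serves to dominate the tail
  of the SINR by an exponential, the upper bound to control the tail for small thresholds.\<close>

lemma euler_integral_bounds:
  fixes t b :: real
  assumes "t \<ge> 0" "b > 0"
  shows "0 \<le> integral {0..1} (\<lambda>w. 1 / (1 + t * w powr (1 / b)))"
    and "integral {0..1} (\<lambda>w. 1 / (1 + t * w powr (1 / b))) \<le> 1"
proof -
  let ?g = "\<lambda>w. 1 / (1 + t * w powr (1 / b))"
  have int: "?g integrable_on {0..1}"
    by (intro integrable_continuous_real continuous_on_subset[OF continuous_on_euler_integrand[OF assms]]) auto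
  show "0 \<le> integral {0..1} ?g"
    using assms by (intro Henstock_Kurzweil_Integration.integral_nonneg int) (auto intro!: add_nonneg_nonneg)
  have "integral {0..1} ?g \<le> integral {0..1} (\<lambda>_::real. 1::real)"
    using assms by (intro Henstock_Kurzweil_Integration.integral_le int) (auto simp: divide_le_eq_1 add_pos_nonneg)
  then show "integral {0..1} ?g \<le> 1" by simp
qed

subsection \<open>SINR, outage and ergodic rate\<close>

text \<open>For \<open>y \<ge> 0\<close>, \<open>ln (1 + y)\<close> is the integral of
  \<open>1 / (t + 1)\<close> over \<open>t\<close> from 0 to \<open>y\<close>; Tonelli then
  exchanges this integral with the expectation.\<close>

lemma (in prob_space) nn_integral_ln_tail:
  fixes Y :: "'a \<Rightarrow> real"
  assumes [measurable]: "Y \<in> borel_measurable M" and nonneg: "AE \<omega> in M. 0 \<le> Y \<omega>"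
  shows "(\<integral>\<^sup>+\<omega>. ennreal (ln (1 + Y \<omega>)) \<partial>M) =
    (\<integral>\<^sup>+t. ennreal (indicator {0..} t * (1 / (t + 1) * prob {\<omega>\<in>space M. t \<le> Y \<omega>})) \<partial>lborel)"
proof -
  interpret pair_sigma_finite M lborel ..
  let ?f = "\<lambda>\<omega> t. ennreal (1 / (t + 1)) * indicator {0..} t * indicator {..Y \<omega>} t"
  have ln: "(\<integral>\<^sup>+t. ?f \<omega> t \<partial>lborel) = ennreal (ln (1 + Y \<omega>))" if "0 \<le> Y \<omega>" for \<omega>
  proof -
    have "(\<integral>\<^sup>+t. ?f \<omega> t \<partial>lborel) = (\<integral>\<^sup>+t. ennreal (1 / (t + 1)) * indicator {0..Y \<omega>} t \<partial>lborel)"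
      by (intro nn_integral_cong) (auto split: split_indicator)
    also have "\<dots> = ennreal (ln (Y \<omega> + 1) - ln (0 + 1))"
      by (rule nn_integral_FTC_Icc) (use that in \<open>auto intro!: derivative_eq_intros\<close>)
    finally show ?thesis by (simp add: add.commute)
  qed
  have "(\<integral>\<^sup>+\<omega>. ennreal (ln (1 + Y \<omega>)) \<partial>M) = (\<integral>\<^sup>+\<omega>. \<integral>\<^sup>+t. ?f \<omega> t \<partial>lborel \<partial>M)"
    by (rule nn_integral_cong_AE) (use nonneg in \<open>auto simp: ln elim!: eventually_mono\<close>)
  also have "\<dots> = (\<integral>\<^sup>+t. \<integral>\<^sup>+\<omega>. ?f \<omega> t \<partial>M \<partial>lborel)"
    by (rule Fubini'[symmetric]) (simp add: indicator_def)
  also have "\<dots> = (\<integral>\<^sup>+t. ennreal (indicator {0..} t * (1 / (t + 1) * prob {\<omega>\<in>space M. t \<le> Y \<omega>})) \<partial>lborel)"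
  proof (rule nn_integral_cong)
    fix t :: real
    have "(\<integral>\<^sup>+\<omega>. ?f \<omega> t \<partial>M) =
        (\<integral>\<^sup>+\<omega>. ennreal (1 / (t + 1)) * indicator {0..} t * indicator {\<omega>\<in>space M. t \<le> Y \<omega>} \<omega> \<partial>M)"
      by (intro nn_integral_cong) (auto split: split_indicator)
    also have "\<dots> = ennreal (1 / (t + 1)) * indicator {0..} t * ennreal (prob {\<omega>\<in>space M. t \<le> Y \<omega>})"
      by (subst nn_integral_cmult_indicator) (auto simp: emeasure_eq_measure)
    also have "\<dots> = ennreal (indicator {0..} t * (1 / (t + 1) * prob {\<omega>\<in>space M. t \<le> Y \<omega>}))"
      by (cases "t \<ge> 0") (simp_all flip: ennreal_mult)
    finally show "(\<integral>\<^sup>+\<omega>. ?f \<omega> t \<partial>M) = ennreal (indicator {0..} t * (1 / (t + 1) * prob {\<omega>\<in>space M. t \<le> Y \<omega>}))" .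
  qed
  finally show ?thesis .
qed

lemma (in prob_space) ergodic_rate_eq_tail:
  assumes [measurable]: "Y \<in> borel_measurable M" and nonneg: "AE \<omega> in M. 0 \<le> Y \<omega>"
  shows "ergodic_rate M Y = (LBINT t:{0..}. 1 / (t + 1) * prob {\<omega>\<in>space M. t \<le> Y \<omega>})"
proof -
  \<comment> \<open>The tail probability is measurable in \<open>t\<close> because it is an integral
    over \<omega> of a jointly measurable function.\<close>
  have "(\<lambda>t. enn2real (\<integral>\<^sup>+\<omega>. indicator {..Y \<omega>} t \<partial>M)) \<in> borel_measurable borel"
    by (simp add: indicator_def)
  also have "(\<lambda>t. enn2real (\<integral>\<^sup>+\<omega>. indicator {..Y \<omega>} t \<partial>M)) = (\<lambda>t. prob {\<omega>\<in>space M. t \<le> Y \<omega>})"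
  proof
    fix t
    have "(\<integral>\<^sup>+\<omega>. indicator {..Y \<omega>} t \<partial>M) = (\<integral>\<^sup>+\<omega>. indicator {\<omega>\<in>space M. t \<le> Y \<omega>} \<omega> \<partial>M)"
      by (intro nn_integral_cong) (auto split: split_indicator)
    then show "enn2real (\<integral>\<^sup>+\<omega>. indicator {..Y \<omega>} t \<partial>M) = prob {\<omega>\<in>space M. t \<le> Y \<omega>}"
      by (simp add: measure_def)
  qed
  finally have [measurable]: "(\<lambda>t. prob {\<omega>\<in>space M. t \<le> Y \<omega>}) \<in> borel_measurable borel" .
  have "ergodic_rate M Y = enn2real (\<integral>\<^sup>+\<omega>. ennreal (ln (1 + Y \<omega>)) \<partial>M)"
    unfolding ergodic_rate_def
    by (rule integral_eq_nn_integral) (use nonneg in \<open>auto elim!: eventually_mono\<close>)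
  also have "\<dots> = (LBINT t:{0..}. 1 / (t + 1) * prob {\<omega>\<in>space M. t \<le> Y \<omega>})"
    unfolding set_lebesgue_integral_def nn_integral_ln_tail[OF assms]
    by (subst integral_eq_nn_integral) (auto split: split_indicator)
  finally show ?thesis .
qed

section \<open>The downlink model; averages over path loss, fading and positions\<close>

locale downlink = prob_space M
  for M :: "'w measure" +
  fixes x :: "nat \<Rightarrow> 'w \<Rightarrow> real^2"
    and h :: "nat \<Rightarrow> 'w \<Rightarrow> complex"
    and \<rho> P N\<^sub>0 r\<^sub>0 \<eta> :: real
  assumes pos: "\<rho> > 0" "P > 0" "N\<^sub>0 > 0" "r\<^sub>0 > 0" "\<eta> > 2"
    and ppp: "homogeneous_ppp_on M \<rho> {y. norm y > r\<^sub>0} x"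
    and indep_h: "indep_vars (\<lambda>_. borel) h UNIV"
    and gauss: "\<And>k. circular_complex_gaussian M 1 (h k)"
    and indep_hx: "indep_rvs M
       (PiM UNIV (\<lambda>_. borel)) (\<lambda>\<omega> k. h k \<omega>) (PiM UNIV (\<lambda>_. borel)) (\<lambda>\<omega> k. x k \<omega>)"
begin

abbreviation "\<Lambda> \<equiv> density lborel (\<lambda>y::real^2. ennreal \<rho> * indicator {y. norm y > r\<^sub>0} y)"

text \<open>Euler's integral with \<open>b = 1 - 2 / \<eta>\<close> at the point \<open>- t\<close>,
  that is, the hypergeometric factor of the final formulas in real form.\<close>

definition euler_int :: "real \<Rightarrow> real" where
  "euler_int t = integral {0..1} (\<lambda>w. 1 / (1 + t * w powr (1 / (1 - 2 / \<eta>))))"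

text \<open>The claimed probability that the SINR is at least \<open>t\<close>. Both the rate and
  the outage probability are computed from it.\<close>

definition ccdf :: "real \<Rightarrow> real" where
  "ccdf t = exp (- (t * N\<^sub>0 * r\<^sub>0 powr \<eta> / P) - 2 * pi * \<rho> * t * r\<^sub>0\<^sup>2 / (\<eta> - 2) * euler_int t)"

lemma measurable_h [measurable]: "h k \<in> borel_measurable M"
  using indep_h by (auto simp: indep_vars_def)

lemma measurable_x [measurable]: "x k \<in> borel_measurable M"
  using ppp by (auto simp: homogeneous_ppp_on_def poisson_point_process_def)

text \<open>Passing to \<open>u = (norm y)\<^sup>2\<close> turns the integral into
  \<open>pi * \<rho>\<close> times the tail integral above with
  \<open>c = r\<^sub>0\<^sup>2\<close>. Here \<psi> is one minus the Laplace transform of the fading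
  of an interferer at \<open>y\<close>.\<close>

lemma integral_path_loss:
  assumes t: "t \<ge> 0"
  defines "\<psi> \<equiv> \<lambda>y::real^2. 1 - 1 / (1 + t * (norm y / r\<^sub>0) powr (- \<eta>))"
  shows "integrable \<Lambda> \<psi>" "integral\<^sup>L \<Lambda> \<psi> = 2 * pi * \<rho> * t * r\<^sub>0\<^sup>2 / (\<eta> - 2) * euler_int t"
proof -
  let ?I = "2 * pi * \<rho> * t * r\<^sub>0\<^sup>2 / (\<eta> - 2) * euler_int t"
  have K: "euler_int t \<ge> 0"
    unfolding euler_int_def using t pos by (intro euler_integral_bounds) auto
  have \<psi>: "0 \<le> \<psi> y" for y
  proof -
    have "1 + t * (norm y / r\<^sub>0) powr (- \<eta>) \<ge> 1" using t by simp
    then show ?thesis unfolding \<psi>_def by simp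
  qed
  have [measurable]: "\<psi> \<in> borel_measurable borel"
    unfolding \<psi>_def by measurable
  let ?g = "\<lambda>u. 1 - 1 / (1 + t * (u / r\<^sub>0\<^sup>2) powr (- (\<eta> / 2)))"
  have "(\<integral>\<^sup>+y. ennreal (\<psi> y) \<partial>\<Lambda>) = (\<integral>\<^sup>+y. (\<lambda>u. ennreal \<rho> * (ennreal (?g u) * indicator {r\<^sub>0\<^sup>2<..} u)) ((norm (y::real^2))\<^sup>2) \<partial>lborel)"
  proof (subst nn_integral_density, measurable, rule nn_integral_cong)
    fix y :: "real^2"
    have "\<not> (norm y)\<^sup>2 \<le> r\<^sub>0\<^sup>2 \<longleftrightarrow> \<not> norm y \<le> r\<^sub>0"
      using pos(4) by (subst power_mono_iff) auto
    then have "indicator {y. norm y > r\<^sub>0} y = (indicator {r\<^sub>0\<^sup>2<..} ((norm y)\<^sup>2) :: ennreal)"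
      by (simp add: indicator_def not_le)
    moreover have "(norm y / r\<^sub>0) powr (- \<eta>) = ((norm y)\<^sup>2 / r\<^sub>0\<^sup>2) powr (- (\<eta> / 2))"
    proof -
      have "((norm y)\<^sup>2 / r\<^sub>0\<^sup>2) = (norm y / r\<^sub>0) powr 2"
        using pos(4) by (simp add: power_divide)
      then show ?thesis by (simp add: powr_powr)
    qed
    ultimately show "ennreal \<rho> * indicator {y. norm y > r\<^sub>0} y * ennreal (\<psi> y) =
        (\<lambda>u. ennreal \<rho> * (ennreal (?g u) * indicator {r\<^sub>0\<^sup>2<..} u)) ((norm y)\<^sup>2)"
      by (simp add: \<psi>_def mult_ac)
  qed
  also have "\<dots> = ennreal pi * (\<integral>\<^sup>+u. ennreal \<rho> * (ennreal (?g u) * indicator {r\<^sub>0\<^sup>2<..} u) * indicator {0..} u \<partial>lborel)"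
    by (rule nn_integral_radial_2) auto
  also have "(\<integral>\<^sup>+u. ennreal \<rho> * (ennreal (?g u) * indicator {r\<^sub>0\<^sup>2<..} u) * indicator {0..} u \<partial>lborel) =
      (\<integral>\<^sup>+u. ennreal \<rho> * (ennreal (?g u) * indicator {r\<^sub>0\<^sup>2..} u) \<partial>lborel)"
  \<comment> \<open>The open and the closed ray differ in the single point
    \<open>r\<^sub>0\<^sup>2\<close>, a null set.\<close>
  proof (rule nn_integral_cong_AE)
    have "AE u in lborel. u \<noteq> r\<^sub>0\<^sup>2" by (rule AE_lborel_singleton)
    then show "AE u in lborel. ennreal \<rho> * (ennreal (?g u) * indicator {r\<^sub>0\<^sup>2<..} u) * indicator {0..} u =
        ennreal \<rho> * (ennreal (?g u) * indicator {r\<^sub>0\<^sup>2..} u)"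
    proof eventually_elim
      case (elim u)
      have "0 \<le> u" if "r\<^sub>0\<^sup>2 < u" using that zero_le_power2[of r\<^sub>0] by linarith
      then show ?case using elim by (auto split: split_indicator)
    qed
  qed
  also have "\<dots> = ennreal \<rho> * ennreal (2 * t * r\<^sub>0\<^sup>2 / (\<eta> - 2) * euler_int t)"
    using pos t unfolding euler_int_def
    by (subst nn_integral_cmult) (simp_all add: nn_integral_path_loss_tail)
  also have "ennreal pi * (ennreal \<rho> * ennreal (2 * t * r\<^sub>0\<^sup>2 / (\<eta> - 2) * euler_int t)) = ennreal ?I"
    using pos t K by (simp add: mult_ac flip: ennreal_mult)
  finally have nn: "(\<integral>\<^sup>+y. ennreal (\<psi> y) \<partial>\<Lambda>) = ennreal ?I" .
  show "integrable \<Lambda> \<psi>"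
    by (rule integrableI_nonneg) (use \<psi> nn in auto)
  show "integral\<^sup>L \<Lambda> \<psi> = ?I"
    by (rule integral_eq_nn_integral[THEN trans]) (use \<psi> nn pos t K in auto)
qed

text \<open>With the interfering links frozen, the exponential tail of the serving link gives
  \<open>exp (- a)\<close> times a product with one factor per interferer. By independence its
  expectation is the product of the Laplace transforms \<open>1 / (1 + b k)\<close>.\<close>

lemma emeasure_fading_tail:
  assumes a: "a \<ge> 0" and b: "\<And>k. b k \<ge> 0"
  shows "emeasure M {\<omega>\<in>space M. a + (\<Sum>k<n. b k * (cmod (h (Suc k) \<omega>))\<^sup>2) \<le> (cmod (h 0 \<omega>))\<^sup>2} =
    ennreal (exp (- a) * (\<Prod>k<n. 1 / (1 + b k)))"
proof -
  \<comment> \<open>The weight is 1 on the serving link and \<open>b k\<close> on link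
    \<open>Suc k\<close>, so that one indexed family carries both the serving link (index 0) and the
    weighted interferers.\<close>
  define G where "G k \<omega> = case_nat 1 b k * (cmod (h k \<omega>))\<^sup>2" for k \<omega>
  have G0: "G 0 \<omega> = (cmod (h 0 \<omega>))\<^sup>2" for \<omega> by (simp add: G_def)
  have GS: "(\<Sum>k\<in>Suc ` {..<n}. G k \<omega>) = (\<Sum>k<n. b k * (cmod (h (Suc k) \<omega>))\<^sup>2)" for \<omega>
    by (simp add: sum.reindex G_def)
  let ?S = "\<lambda>\<omega>. \<Sum>k<n. b k * (cmod (h (Suc k) \<omega>))\<^sup>2"
  have "indep_vars (\<lambda>_. borel) G (insert 0 (Suc ` {..<n}))"
    unfolding G_def by (rule indep_vars_compose2[OF indep_vars_subset[OF indep_h]]) auto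
  from indep_vars_sum[OF _ _ this] have "indep_var borel (G 0) borel (\<lambda>\<omega>. \<Sum>k\<in>Suc ` {..<n}. G k \<omega>)"
    by auto
  then have ind: "indep_rvs M borel (\<lambda>\<omega>. (cmod (h 0 \<omega>))\<^sup>2) borel ?S"
    unfolding GS G0[abs_def] by (rule indep_var_imp_indep_rvs)
  let ?f = "\<lambda>(g, s). indicator {p::real\<times>real. a + snd p \<le> fst p} (g, s) :: ennreal"
  have "emeasure M {\<omega>\<in>space M. a + ?S \<omega> \<le> (cmod (h 0 \<omega>))\<^sup>2} = (\<integral>\<^sup>+\<omega>. ?f ((cmod (h 0 \<omega>))\<^sup>2, ?S \<omega>) \<partial>M)"
    by (subst nn_integral_indicator[symmetric], measurable, rule nn_integral_cong) (auto split: split_indicator)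
  also have "\<dots> = (\<integral>\<^sup>+\<omega>'. \<integral>\<^sup>+\<omega>. ?f ((cmod (h 0 \<omega>))\<^sup>2, ?S \<omega>') \<partial>M \<partial>M)"
    by (rule nn_integral_indep_rvs[OF ind]) measurable
  also have "\<dots> = (\<integral>\<^sup>+\<omega>'. ennreal (exp (- a)) * (\<Prod>k<n. ennreal (exp (- (b k * (cmod (h (Suc k) \<omega>'))\<^sup>2)))) \<partial>M)"
  proof (rule nn_integral_cong)
    fix \<omega>'
    have S: "0 \<le> ?S \<omega>'" using b by (intro sum_nonneg) simp
    have "(\<integral>\<^sup>+\<omega>. ?f ((cmod (h 0 \<omega>))\<^sup>2, ?S \<omega>') \<partial>M) = emeasure M {\<omega>\<in>space M. a + ?S \<omega>' \<le> (cmod (h 0 \<omega>))\<^sup>2}"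
      by (subst nn_integral_indicator[symmetric], measurable, rule nn_integral_cong) (auto split: split_indicator)
    also have "\<dots> = ennreal (exp (- (a + ?S \<omega>')))"
      by (rule tail_circular_complex_gaussian_sq[OF gauss]) (use a S in simp)
    also have "exp (- (a + ?S \<omega>')) = exp (- a) * (\<Prod>k<n. exp (- (b k * (cmod (h (Suc k) \<omega>'))\<^sup>2)))"
      by (simp add: exp_add[symmetric] exp_sum[symmetric] sum_negf)
    finally show "(\<integral>\<^sup>+\<omega>. ?f ((cmod (h 0 \<omega>))\<^sup>2, ?S \<omega>') \<partial>M) =
        ennreal (exp (- a)) * (\<Prod>k<n. ennreal (exp (- (b k * (cmod (h (Suc k) \<omega>'))\<^sup>2))))"
      by (simp add: ennreal_mult prod_ennreal prod_nonneg)
  qed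
  also have "\<dots> = ennreal (exp (- a)) * (\<integral>\<^sup>+\<omega>. (\<Prod>k<n. ennreal (exp (- (b k * (cmod (h (Suc k) \<omega>))\<^sup>2)))) \<partial>M)"
    by (rule nn_integral_cmult) measurable
  also have "(\<integral>\<^sup>+\<omega>. (\<Prod>k<n. ennreal (exp (- (b k * (cmod (h (Suc k) \<omega>))\<^sup>2)))) \<partial>M) =
      (\<Prod>k<n. \<integral>\<^sup>+\<omega>. ennreal (exp (- (b k * (cmod (h (Suc k) \<omega>))\<^sup>2))) \<partial>M)"
  proof -
    have "indep_vars (\<lambda>_. borel) (\<lambda>k \<omega>. ennreal (exp (- G k \<omega>))) (Suc ` {..<n})"
      unfolding G_def by (rule indep_vars_compose2[OF indep_vars_subset[OF indep_h]]) auto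
    from indep_vars_nn_integral[OF _ this] show ?thesis
      by (simp add: prod.reindex G_def)
  qed
  also have "\<dots> = (\<Prod>k<n. ennreal (1 / (1 + b k)))"
    using laplace_circular_complex_gaussian_sq[OF gauss b] by simp
  also have "ennreal (exp (- a)) * \<dots> = ennreal (exp (- a) * (\<Prod>k<n. 1 / (1 + b k)))"
    using b by (simp add: ennreal_mult prod_ennreal prod_nonneg add_nonneg_nonneg)
  finally show ?thesis .
qed

text \<open>Positions and fading are independent as whole sequences. Freezing the positions reduces
  the inner probability to the fading tail with \<open>b k = \<beta> (x k \<omega>')\<close>, which
  is then averaged over the positions.\<close>

lemma prob_partial_interference:
  fixes \<beta> :: "real^2 \<Rightarrow> real"
  assumes a: "a \<ge> 0" and \<beta>: "\<And>y. \<beta> y \<ge> 0" and [measurable]: "\<beta> \<in> borel_measurable borel"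
  shows "prob {\<omega>\<in>space M. a + (\<Sum>k<n. \<beta> (x k \<omega>) * (cmod (h (Suc k) \<omega>))\<^sup>2) \<le> (cmod (h 0 \<omega>))\<^sup>2} =
    exp (- a) * expectation (\<lambda>\<omega>. \<Prod>k<n. 1 / (1 + \<beta> (x k \<omega>)))"
proof -
  let ?PH = "PiM UNIV (\<lambda>_. borel) :: (nat \<Rightarrow> complex) measure"
  let ?PX = "PiM UNIV (\<lambda>_. borel) :: (nat \<Rightarrow> real^2) measure"
  let ?E = "{p. a + (\<Sum>k<n. \<beta> (snd p k) * (cmod (fst p (Suc k)))\<^sup>2) \<le> (cmod (fst p 0))\<^sup>2}"
  have [measurable]: "(\<lambda>p. fst p k) \<in> borel_measurable (?PH \<Otimes>\<^sub>M ?PX)" for k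
    by (rule measurable_compose[OF measurable_fst measurable_component_singleton]) simp
  have [measurable]: "(\<lambda>p. snd p k) \<in> borel_measurable (?PH \<Otimes>\<^sub>M ?PX)" for k
    by (rule measurable_compose[OF measurable_snd measurable_component_singleton]) simp
  have [measurable]: "Measurable.pred (?PH \<Otimes>\<^sub>M ?PX) (\<lambda>p. p \<in> ?E)"
    by simp
  have "emeasure M {\<omega>\<in>space M. a + (\<Sum>k<n. \<beta> (x k \<omega>) * (cmod (h (Suc k) \<omega>))\<^sup>2) \<le> (cmod (h 0 \<omega>))\<^sup>2} =
      (\<integral>\<^sup>+\<omega>. indicator ?E (\<lambda>k. h k \<omega>, \<lambda>k. x k \<omega>) \<partial>M)"
    by (subst nn_integral_indicator[symmetric], measurable, rule nn_integral_cong) (auto split: split_indicator)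
  also have "\<dots> = (\<integral>\<^sup>+\<omega>'. \<integral>\<^sup>+\<omega>. indicator ?E (\<lambda>k. h k \<omega>, \<lambda>k. x k \<omega>') \<partial>M \<partial>M)"
    by (rule nn_integral_indep_rvs[OF indep_hx]) measurable
  also have "\<dots> = (\<integral>\<^sup>+\<omega>'. ennreal (exp (- a) * (\<Prod>k<n. 1 / (1 + \<beta> (x k \<omega>')))) \<partial>M)"
  proof (rule nn_integral_cong)
    fix \<omega>'
    have "(\<integral>\<^sup>+\<omega>. indicator ?E (\<lambda>k. h k \<omega>, \<lambda>k. x k \<omega>') \<partial>M) =
       emeasure M {\<omega>\<in>space M. a + (\<Sum>k<n. \<beta> (x k \<omega>') * (cmod (h (Suc k) \<omega>))\<^sup>2) \<le> (cmod (h 0 \<omega>))\<^sup>2}"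
      by (subst nn_integral_indicator[symmetric], measurable, rule nn_integral_cong) (auto split: split_indicator)
    also have "\<dots> = ennreal (exp (- a) * (\<Prod>k<n. 1 / (1 + \<beta> (x k \<omega>'))))"
      by (rule emeasure_fading_tail[OF a \<beta>])
    finally show "(\<integral>\<^sup>+\<omega>. indicator ?E (\<lambda>k. h k \<omega>, \<lambda>k. x k \<omega>') \<partial>M) =
        ennreal (exp (- a) * (\<Prod>k<n. 1 / (1 + \<beta> (x k \<omega>'))))" .
  qed
  also have "\<dots> = ennreal (expectation (\<lambda>\<omega>. exp (- a) * (\<Prod>k<n. 1 / (1 + \<beta> (x k \<omega>)))))"
  proof (rule nn_integral_eq_integral)
    have "0 \<le> (\<Prod>k<n. 1 / (1 + \<beta> (x k \<omega>)))" "(\<Prod>k<n. 1 / (1 + \<beta> (x k \<omega>))) \<le> 1" for \<omega>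
      using \<beta> by (auto intro!: prod_nonneg prod_le_1 add_nonneg_nonneg simp: add_pos_nonneg)
    then show "integrable M (\<lambda>\<omega>. exp (- a) * (\<Prod>k<n. 1 / (1 + \<beta> (x k \<omega>))))"
      and "AE \<omega> in M. 0 \<le> exp (- a) * (\<Prod>k<n. 1 / (1 + \<beta> (x k \<omega>)))"
      by (auto intro!: integrable_const_bound[where B = 1])
  qed
  finally show ?thesis
    using \<beta> by (simp add: emeasure_eq_measure prod_nonneg add_nonneg_nonneg)
qed

section \<open>The tail of the SINR\<close>

abbreviation "received_power k \<omega> \<equiv> P * (cmod (h (Suc k) \<omega>))\<^sup>2 * norm (x k \<omega>) powr (- \<eta>)"

lemma measurable_interference [measurable]: "interference P \<eta> x h \<in> borel_measurable M"
  unfolding interference_def[abs_def] by measurable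

lemma measurable_sinr [measurable]: "sinr P N\<^sub>0 \<eta> r\<^sub>0 x h \<in> borel_measurable M"
  unfolding sinr_def[abs_def] by measurable

text \<open>Real series converge exactly when their partial sums are Cauchy, and this is a condition
  on countably many measurable functions.\<close>

lemma pred_summable_received_power [measurable]: "Measurable.pred M (\<lambda>\<omega>. summable (\<lambda>k. received_power k \<omega>))"
  unfolding pred_def summable_iff_convergent Cauchy_convergent_iff[symmetric]
  by (rule sets_Collect_Cauchy) measurable

text \<open>Bounded partial sums of nonnegative terms converge, so the bounds for all finite sets of
  leading interferers together amount to summability and \<open>T \<le> \<Upsilon>\<close>.
  Summability stands in the event because the sum of a divergent series carries no information.
  Continuity from above gives the limit of the probabilities on one side, the Laplace functional on
  the other.\<close>

lemma prob_summable_sinr_ge: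
  assumes T: "T > 0"
  shows "prob {\<omega>\<in>space M. summable (\<lambda>k. received_power k \<omega>) \<and> T \<le> sinr P N\<^sub>0 \<eta> r\<^sub>0 x h \<omega>} = ccdf T"
proof -
  \<comment> \<open>With this factor, \<open>T \<le> \<Upsilon>\<close> means that \<kappa> times
    interference plus noise is at most the squared modulus of \<open>h 0\<close>. The function
    \<beta> below is \<kappa> times the mean power received from \<open>y\<close>.\<close>
  define \<kappa> where "\<kappa> = T * r\<^sub>0 powr \<eta> / P"
  define \<beta> where "\<beta> y = T * (norm y / r\<^sub>0) powr (- \<eta>)" for y :: "real^2"
  define A where "A n = {\<omega>\<in>space M. \<kappa> * N\<^sub>0 + (\<Sum>k<n. \<beta> (x k \<omega>) * (cmod (h (Suc k) \<omega>))\<^sup>2) \<le> (cmod (h 0 \<omega>))\<^sup>2}" for n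
  have \<kappa>: "\<kappa> > 0" using T pos by (simp add: \<kappa>_def)
  have [measurable]: "\<beta> \<in> borel_measurable borel" unfolding \<beta>_def[abs_def] by measurable
  have \<beta>: "\<beta> y \<ge> 0" for y using T by (simp add: \<beta>_def)
  have received_power_eq: "\<beta> (x k \<omega>) * (cmod (h (Suc k) \<omega>))\<^sup>2 = \<kappa> * received_power k \<omega>" for k \<omega>
    using pos by (simp add: \<beta>_def \<kappa>_def powr_divide powr_minus field_simps)
  have received_power_nonneg: "received_power k \<omega> \<ge> 0" for k \<omega> using pos by simp
  have [measurable]: "A n \<in> sets M" for n unfolding A_def by measurable
  have "decseq A"
    unfolding A_def by (rule decseq_SucI) (auto intro: order_trans[rotated] simp: \<beta>)
  then have "(\<lambda>n. prob (A n)) \<longlonglongrightarrow> prob (\<Inter>n. A n)"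
    by (intro finite_Lim_measure_decseq) auto
  also have "(\<Inter>n. A n) = {\<omega>\<in>space M. summable (\<lambda>k. received_power k \<omega>) \<and> T \<le> sinr P N\<^sub>0 \<eta> r\<^sub>0 x h \<omega>}"
  proof -
    have "(\<forall>n. \<kappa> * N\<^sub>0 + (\<Sum>k<n. \<kappa> * received_power k \<omega>) \<le> (cmod (h 0 \<omega>))\<^sup>2) \<longleftrightarrow>
        summable (\<lambda>k. received_power k \<omega>) \<and> T \<le> sinr P N\<^sub>0 \<eta> r\<^sub>0 x h \<omega>" (is "?L \<longleftrightarrow> ?R") for \<omega>
    proof -
      let ?g = "(cmod (h 0 \<omega>))\<^sup>2"
      have sinr: "T \<le> sinr P N\<^sub>0 \<eta> r\<^sub>0 x h \<omega> \<longleftrightarrow> \<kappa> * (interference P \<eta> x h \<omega> + N\<^sub>0) \<le> ?g"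
        if "summable (\<lambda>k. received_power k \<omega>)"
      proof -
        have "interference P \<eta> x h \<omega> \<ge> 0"
          unfolding interference_def using that received_power_nonneg by (rule suminf_nonneg)
        then have I: "interference P \<eta> x h \<omega> + N\<^sub>0 > 0" using pos by simp
        have R: "r\<^sub>0 powr \<eta> > 0" using pos by simp
        have "T \<le> sinr P N\<^sub>0 \<eta> r\<^sub>0 x h \<omega> \<longleftrightarrow> T * (interference P \<eta> x h \<omega> + N\<^sub>0) \<le> P * ?g / r\<^sub>0 powr \<eta>"
          unfolding sinr_def by (subst pos_le_divide_eq[OF I]) (simp add: powr_minus divide_inverse)
        also have "\<dots> \<longleftrightarrow> T * (interference P \<eta> x h \<omega> + N\<^sub>0) * r\<^sub>0 powr \<eta> \<le> P * ?g"
          by (rule pos_le_divide_eq[OF R])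
        also have "\<dots> \<longleftrightarrow> T * r\<^sub>0 powr \<eta> * (interference P \<eta> x h \<omega> + N\<^sub>0) / P \<le> ?g"
          by (simp only: pos_divide_le_eq[OF pos(2)] mult_ac)
        finally show ?thesis by (simp add: \<kappa>_def)
      qed
      have part: "\<kappa> * N\<^sub>0 + (\<Sum>k<n. \<kappa> * received_power k \<omega>) \<le> ?g \<longleftrightarrow> (\<Sum>k<n. received_power k \<omega>) \<le> ?g / \<kappa> - N\<^sub>0" for n
        unfolding sum_distrib_left[symmetric] using \<kappa> by (simp add: field_simps)
      show ?thesis
      proof
        assume ?L
        then have le: "(\<Sum>k<n. received_power k \<omega>) \<le> ?g / \<kappa> - N\<^sub>0" for n
          by (simp only: part)
        have summ: "summable (\<lambda>k. received_power k \<omega>)"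
          by (rule summableI_nonneg_bounded[OF received_power_nonneg le])
        have "interference P \<eta> x h \<omega> \<le> ?g / \<kappa> - N\<^sub>0"
          unfolding interference_def by (rule suminf_le_const[OF summ le])
        then show ?R using summ \<kappa> by (simp add: sinr field_simps)
      next
        assume R: ?R
        then have "interference P \<eta> x h \<omega> \<le> ?g / \<kappa> - N\<^sub>0"
          using sinr \<kappa> by (simp add: field_simps)
        moreover have "(\<Sum>k<n. received_power k \<omega>) \<le> interference P \<eta> x h \<omega>" for n
          unfolding interference_def using R received_power_nonneg by (intro sum_le_suminf) auto
        ultimately have "(\<Sum>k<n. received_power k \<omega>) \<le> ?g / \<kappa> - N\<^sub>0" for n
          by (rule order_trans[rotated])
        then show ?L unfolding part by (rule allI)
      qed
    qed
    then show ?thesis by (auto simp: A_def received_power_eq)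
  qed
  finally have lim1: "(\<lambda>n. prob (A n)) \<longlonglongrightarrow>
      prob {\<omega>\<in>space M. summable (\<lambda>k. received_power k \<omega>) \<and> T \<le> sinr P N\<^sub>0 \<eta> r\<^sub>0 x h \<omega>}" .
  \<comment> \<open>By this choice \<open>1 - \<psi> y = 1 / (1 + \<beta> y)\<close>, so the
    products in the Laplace functional are those left by averaging over the fading.\<close>
  define \<psi> where "\<psi> y = 1 - 1 / (1 + T * (norm y / r\<^sub>0) powr (- \<eta>))" for y :: "real^2"
  have \<psi>01: "0 \<le> \<psi> y" "\<psi> y \<le> 1" for y
  proof -
    have "1 + T * (norm y / r\<^sub>0) powr (- \<eta>) \<ge> 1" using T by simp
    then show "0 \<le> \<psi> y" "\<psi> y \<le> 1" unfolding \<psi>_def by simp_all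
  qed
  have int: "integrable \<Lambda> \<psi>" "integral\<^sup>L \<Lambda> \<psi> = 2 * pi * \<rho> * T * r\<^sub>0\<^sup>2 / (\<eta> - 2) * euler_int T"
    unfolding \<psi>_def by (rule integral_path_loss; use T in simp)+
  have "(\<lambda>n. exp (- (\<kappa> * N\<^sub>0)) * expectation (\<lambda>\<omega>. \<Prod>k<n. 1 - \<psi> (x k \<omega>))) \<longlonglongrightarrow>
      exp (- (\<kappa> * N\<^sub>0)) * exp (- integral\<^sup>L \<Lambda> \<psi>)"
    using ppp by (intro tendsto_mult tendsto_const poisson_laplace_functional int \<psi>01)
      (simp add: homogeneous_ppp_on_def)
  also have "(\<lambda>n. exp (- (\<kappa> * N\<^sub>0)) * expectation (\<lambda>\<omega>. \<Prod>k<n. 1 - \<psi> (x k \<omega>))) = (\<lambda>n. prob (A n))"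
    unfolding A_def using \<kappa> pos
    by (subst prob_partial_interference) (auto simp: \<beta> \<psi>_def \<beta>_def[symmetric])
  also have "exp (- (\<kappa> * N\<^sub>0)) * exp (- integral\<^sup>L \<Lambda> \<psi>) = ccdf T"
    by (simp add: ccdf_def int(2) \<kappa>_def exp_add[symmetric] mult_ac)
  finally show ?thesis using lim1 LIMSEQ_unique by blast
qed

text \<open>Almost sure convergence of the interference comes for free from the previous lemma as \<open>T \<rightarrow> 0\<close>.\<close>
lemma AE_summable: "AE \<omega> in M. summable (\<lambda>k. received_power k \<omega>)"
proof -
  \<comment> \<open>Since \<open>euler_int\<close> is at most 1, the exponent of
    \<open>ccdf T\<close> is at least \<open>- (C * T)\<close>.\<close>
  define C where "C = N\<^sub>0 * r\<^sub>0 powr \<eta> / P + 2 * pi * \<rho> * r\<^sub>0\<^sup>2 / (\<eta> - 2)"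
  have le: "exp (- (C * T)) \<le> prob {\<omega>\<in>space M. summable (\<lambda>k. received_power k \<omega>)}" if T: "T > 0" for T
  proof -
    have "euler_int T \<le> 1"
      unfolding euler_int_def using T pos by (intro euler_integral_bounds) auto
    then have "2 * pi * \<rho> * T * r\<^sub>0\<^sup>2 / (\<eta> - 2) * euler_int T \<le> 2 * pi * \<rho> * T * r\<^sub>0\<^sup>2 / (\<eta> - 2)"
      using T pos by (intro mult_left_le) auto
    then have "exp (- (C * T)) \<le> ccdf T"
      by (simp add: C_def ccdf_def field_simps)
    also have "\<dots> \<le> prob {\<omega>\<in>space M. summable (\<lambda>k. received_power k \<omega>)}"
      unfolding prob_summable_sinr_ge[OF T, symmetric] by (rule finite_measure_mono) auto
    finally show ?thesis .
  qed
  have "(\<lambda>n. exp (- (C * inverse (real (Suc n))))) \<longlonglongrightarrow> exp (- (C * 0))"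
    by (intro tendsto_intros LIMSEQ_inverse_real_of_nat)
  then have "exp (- (C * 0)) \<le> prob {\<omega>\<in>space M. summable (\<lambda>k. received_power k \<omega>)}"
    by (rule LIMSEQ_le_const2) (use le in auto)
  then have "prob {\<omega>\<in>space M. summable (\<lambda>k. received_power k \<omega>)} = 1"
    using prob_le_1 by (simp add: order_antisym)
  then show ?thesis by (simp add: prob_Collect_eq_1)
qed

lemma AE_sinr_nonneg: "AE \<omega> in M. 0 \<le> sinr P N\<^sub>0 \<eta> r\<^sub>0 x h \<omega>"
  using AE_summable
proof eventually_elim
  case (elim \<omega>)
  then have "0 \<le> interference P \<eta> x h \<omega>"
    unfolding interference_def using pos by (intro suminf_nonneg) auto
  then show ?case using pos by (simp add: sinr_def)
qed

text \<open>Summability holds almost surely and drops out of the event. The threshold 0 is included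
  so that the formula holds on the whole closed half-line of the rate integral; there both sides are
  1.\<close>

lemma prob_sinr_ge:
  assumes "T \<ge> 0"
  shows "prob {\<omega>\<in>space M. T \<le> sinr P N\<^sub>0 \<eta> r\<^sub>0 x h \<omega>} = ccdf T"
proof (cases "T = 0")
  case True
  then show ?thesis using AE_sinr_nonneg by (simp add: ccdf_def prob_Collect_eq_1)
next
  case False
  have "prob {\<omega>\<in>space M. T \<le> sinr P N\<^sub>0 \<eta> r\<^sub>0 x h \<omega>} =
      prob {\<omega>\<in>space M. summable (\<lambda>k. received_power k \<omega>) \<and> T \<le> sinr P N\<^sub>0 \<eta> r\<^sub>0 x h \<omega>}"
    by (rule measure_eq_AE) (use AE_summable in auto)
  then show ?thesis using prob_summable_sinr_ge assms False by simp
qed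

section \<open>Outage probability and ergodic rate\<close>

lemma outage_probability_eq:
  assumes "T > 0"
  shows "outage_probability M (sinr P N\<^sub>0 \<eta> r\<^sub>0 x h) T = 1 - ccdf T"
proof -
  have "{\<omega>\<in>space M. sinr P N\<^sub>0 \<eta> r\<^sub>0 x h \<omega> < T} = space M - {\<omega>\<in>space M. T \<le> sinr P N\<^sub>0 \<eta> r\<^sub>0 x h \<omega>}"
    by auto
  then show ?thesis
    using assms by (simp add: outage_probability_def prob_compl prob_sinr_ge)
qed

lemma ergodic_rate_eq:
  "ergodic_rate M (sinr P N\<^sub>0 \<eta> r\<^sub>0 x h) = (LBINT t:{0..}. 1 / (t + 1) * ccdf t)"
proof -
  have "(LBINT t:{0..}. 1 / (t + 1) * prob {\<omega>\<in>space M. t \<le> sinr P N\<^sub>0 \<eta> r\<^sub>0 x h \<omega>}) =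
      (LBINT t:{0..}. 1 / (t + 1) * ccdf t)"
    by (rule set_lebesgue_integral_cong) (auto simp: prob_sinr_ge)
  then show ?thesis
    using ergodic_rate_eq_tail[OF measurable_sinr AE_sinr_nonneg] by simp
qed

text \<open>The noise term alone makes the tail decay at least like \<open>exp (- (c * t))\<close>
  with \<open>c > 0\<close>. Integrability ensures that \<open>ergodic_rate\<close> is a genuine
  expectation and not the default value 0 of a divergent integral.\<close>

lemma integrable_ln_sinr: "integrable M (\<lambda>\<omega>. ln (1 + sinr P N\<^sub>0 \<eta> r\<^sub>0 x h \<omega>))"
proof (rule integrableI_nonneg)
  define c where "c = N\<^sub>0 * r\<^sub>0 powr \<eta> / P"
  have c: "c > 0" using pos by (simp add: c_def)
  have "(\<integral>\<^sup>+\<omega>. ennreal (ln (1 + sinr P N\<^sub>0 \<eta> r\<^sub>0 x h \<omega>)) \<partial>M) \<le>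
      (\<integral>\<^sup>+t. ennreal (exp (- (c * t))) * indicator {0..} t \<partial>lborel)"
    unfolding nn_integral_ln_tail[OF measurable_sinr AE_sinr_nonneg]
  proof (rule nn_integral_mono)
    fix t :: real
    have "1 / (t + 1) * ccdf t \<le> exp (- (c * t))" if t: "t \<ge> 0"
    proof -
      have "0 \<le> euler_int t"
        unfolding euler_int_def using t pos by (intro euler_integral_bounds) auto
      then have "0 \<le> 2 * pi * \<rho> * t * r\<^sub>0\<^sup>2 / (\<eta> - 2) * euler_int t"
        using t pos by simp
      then have "ccdf t \<le> exp (- (c * t))"
        by (simp add: ccdf_def c_def mult_ac)
      moreover have "1 / (t + 1) \<le> 1" using t by simp
      ultimately show ?thesis
        using mult_mono[of "1 / (t + 1)" 1 "ccdf t"] t by (simp add: ccdf_def)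
    qed
    then show "ennreal (indicator {0..} t * (1 / (t + 1) * prob {\<omega>\<in>space M. t \<le> sinr P N\<^sub>0 \<eta> r\<^sub>0 x h \<omega>}))
        \<le> ennreal (exp (- (c * t))) * indicator {0..} t"
      by (auto simp: prob_sinr_ge split: split_indicator intro!: ennreal_leI)
  qed
  also have "\<dots> = ennreal (exp (- (c * 0)) / c)"
    by (rule nn_integral_exp_minus_atLeast[OF c])
  finally show "(\<integral>\<^sup>+\<omega>. ennreal (ln (1 + sinr P N\<^sub>0 \<eta> r\<^sub>0 x h \<omega>)) \<partial>M) < \<infinity>"
    by (rule order.strict_trans1) simp
  show "AE \<omega> in M. 0 \<le> ln (1 + sinr P N\<^sub>0 \<eta> r\<^sub>0 x h \<omega>)"
    using AE_sinr_nonneg by eventually_elim simp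
qed measurable

text \<open>Euler's integral with \<open>b = 1 - 2 / \<eta>\<close>, which is positive because
  \<open>\<eta> > 2\<close>, and \<open>b + 1 = 2 - 2 / \<eta>\<close>.\<close>

lemma ccdf_hyp2F1:
  assumes "t \<ge> 0"
  shows "ccdf t = exp (- (t * N\<^sub>0 * r\<^sub>0 powr \<eta> / P) - 2 * pi * \<rho> * t * r\<^sub>0\<^sup>2 / (\<eta> - 2) *
    Re (hyp2F1 1 (of_real (1 - 2 / \<eta>)) (of_real (2 - 2 / \<eta>)) (of_real (- t))))"
proof -
  have "1 - 2 / \<eta> > 0" using pos by simp
  from Re_hyp2F1_euler_integral[OF assms this]
  have "Re (hyp2F1 1 (of_real (1 - 2 / \<eta>)) (of_real (2 - 2 / \<eta>)) (of_real (- t))) = euler_int t"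
    by (simp add: euler_int_def)
  then show ?thesis by (simp only: ccdf_def)
qed

lemma ccdf_arctan:
  assumes "t \<ge> 0" "\<eta> = 4"
  shows "ccdf t = exp (- (t * N\<^sub>0 * r\<^sub>0 ^ 4 / P) - pi * \<rho> * sqrt t * r\<^sub>0\<^sup>2 * arctan (sqrt t))"
\<comment> \<open>The arctangent form of Euler's integral divides by \<open>sqrt t\<close>, so
  \<open>t = 0\<close> is treated separately.\<close>
proof (cases "t = 0")
  case True
  then show ?thesis by (simp add: ccdf_def)
next
  case False
  then have t: "t > 0" using assms by simp
  have "1 / (1 - 2 / \<eta>) = 2" using assms(2) by simp
  then have "euler_int t = arctan (sqrt t) / sqrt t"
    using euler_integral_half[OF t] by (simp only: euler_int_def)
  then have "2 * pi * \<rho> * t * r\<^sub>0\<^sup>2 / (\<eta> - 2) * euler_int t =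
      pi * \<rho> * (t * (arctan (sqrt t) / sqrt t)) * r\<^sub>0\<^sup>2"
    using assms(2) by (simp only:) simp
  also have "t * (arctan (sqrt t) / sqrt t) = sqrt t * arctan (sqrt t)"
    using t by (simp add: field_simps)
  finally have "2 * pi * \<rho> * t * r\<^sub>0\<^sup>2 / (\<eta> - 2) * euler_int t =
      pi * \<rho> * sqrt t * r\<^sub>0\<^sup>2 * arctan (sqrt t)"
    by (simp only: mult_ac)
  moreover have "r\<^sub>0 powr \<eta> = r\<^sub>0 ^ 4"
    using pos(4) assms(2) by simp
  ultimately show ?thesis
    by (simp only: ccdf_def)
qed

end

theorem theorem4:
  fixes M :: "'w measure"
    and x :: "nat \<Rightarrow> 'w \<Rightarrow> real^2"
    and h :: "nat \<Rightarrow> 'w \<Rightarrow> complex"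
    and \<rho> P N\<^sub>0 r\<^sub>0 \<eta> :: real
  assumes "\<rho> > 0" "P > 0" "N\<^sub>0 > 0" "r\<^sub>0 > 0" "\<eta> > 2"
    and "prob_space M"
    and "homogeneous_ppp_on M \<rho> {y. norm y > r\<^sub>0} x"
    and "prob_space.indep_vars M (\<lambda>_. borel) h UNIV"
    and "\<And>k. circular_complex_gaussian M 1 (h k)"
    and "indep_rvs M
       (PiM UNIV (\<lambda>_. borel)) (\<lambda>\<omega> k. h k \<omega>) (PiM UNIV (\<lambda>_. borel)) (\<lambda>\<omega> k. x k \<omega>)"
  shows "integrable M (\<lambda>\<omega>. ln (1 + sinr P N\<^sub>0 \<eta> r\<^sub>0 x h \<omega>)) \<and>
    (ergodic_rate M (sinr P N\<^sub>0 \<eta> r\<^sub>0 x h) =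
       (LBINT t:{0..}. 1 / (t + 1) *
          exp (- (t * N\<^sub>0 * r\<^sub>0 powr \<eta> / P)
               - 2 * pi * \<rho> * t * r\<^sub>0\<^sup>2 / (\<eta> - 2) *
                 Re (hyp2F1 1 (of_real (1 - 2 / \<eta>)) (of_real (2 - 2 / \<eta>)) (of_real (- t)))))) \<and>
    (\<eta> = 4 \<longrightarrow> ergodic_rate M (sinr P N\<^sub>0 \<eta> r\<^sub>0 x h) =
       (LBINT t:{0..}. 1 / (t + 1) *
          exp (- (t * N\<^sub>0 * r\<^sub>0 ^ 4 / P) - pi * \<rho> * sqrt t * r\<^sub>0\<^sup>2 * arctan (sqrt t)))) \<and>
    (\<forall>T>0. outage_probability M (sinr P N\<^sub>0 \<eta> r\<^sub>0 x h) T =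
       1 - exp (- (T * N\<^sub>0 * r\<^sub>0 powr \<eta> / P)
                - 2 * pi * \<rho> * T * r\<^sub>0\<^sup>2 / (\<eta> - 2) *
                  Re (hyp2F1 1 (of_real (1 - 2 / \<eta>)) (of_real (2 - 2 / \<eta>)) (of_real (- T))))) \<and>
    (\<eta> = 4 \<longrightarrow> (\<forall>T>0. outage_probability M (sinr P N\<^sub>0 \<eta> r\<^sub>0 x h) T =
       1 - exp (- (T * N\<^sub>0 * r\<^sub>0 ^ 4 / P) - pi * \<rho> * sqrt T * r\<^sub>0\<^sup>2 * arctan (sqrt T))))"
proof -
  interpret prob_space M by fact
  interpret downlink M x h \<rho> P N\<^sub>0 r\<^sub>0 \<eta>
    by unfold_locales (use assms in auto)
  \<comment> \<open>Rate and outage depend on \<open>ccdf\<close> only through its values at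
    \<open>t \<ge> 0\<close>, so each closed form of \<open>ccdf\<close> yields both
    formulas.\<close>
  have rate: "ergodic_rate M (sinr P N\<^sub>0 \<eta> r\<^sub>0 x h) = (LBINT t:{0..}. 1 / (t + 1) * f t)"
    if "\<And>t. t \<ge> 0 \<Longrightarrow> ccdf t = f t" for f
    unfolding ergodic_rate_eq by (rule set_lebesgue_integral_cong) (auto simp: that)
  have outage: "outage_probability M (sinr P N\<^sub>0 \<eta> r\<^sub>0 x h) T = 1 - f T"
    if "\<And>t. t \<ge> 0 \<Longrightarrow> ccdf t = f t" "T > 0" for f T
    unfolding outage_probability_eq[OF that(2)] using that by simp
  show ?thesis
    by (intro conjI allI impI integrable_ln_sinr rate outage ccdf_hyp2F1 ccdf_arctan)
qed

end
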